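(* Assume conditions A, D' and E' hold for the semi-Markov processes $\eta^{(\varepsilon)}(t)$, $\varepsilon\in(0,\varepsilon_0]$, together with the paper's standing regularity conditions on the semi-Markov kernels, and let $\delta^*=\min_{i\in\mathbb{X},\,j\in\mathbb{Y}_i}(\delta_{ij}\wedge\dot\delta_{ij})$. Then for every $i\in\mathbb{X}$ the expected return time $E_{ii}(\varepsilon)$ admits a pivotal Laurent expansion with a power-type remainder bound of exponent $\delta^*$: there exist integers $M^-_{ii}\le M^+_{ii}$, reals $B_{ii}[l]$, $M^-_{ii}\le l\le M^+_{ii}$, with $B_{ii}[M^-_{ii}]\ne0$, and constants $G^*_{ii}\in(0,\infty)$, $\dot\varepsilon_{ii}\in(0,\varepsilon_0]$ such that $\big|E_{ii}(\varepsilon)-\sum_{l=M^-_{ii}}^{M^+_{ii}}B_{ii}[l]\varepsilon^l\big|\le G^*_{ii}\varepsilon^{M^+_{ii}+\delta^*}$ for $0<\varepsilon\le\dot\varepsilon_{ii}$.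
   Context: Let $\mathbb{X}=\{1,\dots,N\}$, $0<\varepsilon_0\le1$. For each $\varepsilon\in(0,\varepsilon_0]$, $\eta^{(\varepsilon)}(t)$ is a semi-Markov process on $\mathbb{X}$ with jump times $0=\tau_0<\tau_1<\cdots$, embedded Markov chain $\eta_n=\eta^{(\varepsilon)}(\tau_n)$ and sojourn times $\kappa_{n+1}=\tau_{n+1}-\tau_n$, with semi-Markov transition probabilities $Q^{(\varepsilon)}_{ij}(t)=P(\eta_{n+1}=j,\kappa_{n+1}\le t\mid\eta_n=i)$; $p_{ij}(\varepsilon)=Q^{(\varepsilon)}_{ij}(\infty)$ and $e_{ij}(\varepsilon)=\int_0^\infty t\,Q^{(\varepsilon)}_{ij}(dt)$ (finite). The paper also assumes standing regularity conditions on $Q^{(\varepsilon)}_{ij}$ guaranteeing a well-defined process with finite $e_{ij}$. $E_{ii}(\varepsilon)$ is the expectation of $\tau_{\nu_i}$, where $\nu_i=\min\{n\ge1:\eta_n=i\}$, for the process started at $\eta_0=i$. Condition A: there are nonempty $\mathbb{Y}_i\subseteq\mathbb{X}$ with (a) $p_{ij}(\varepsilon)>0$ for $j\in\mathbb{Y}_i$; (b) $p_{ij}(\varepsilon)=0$ for $j\notin\mathbb{Y}_i$; (c) for all $i,j$ there are $n\ge1$ and $i=l_0,\dots,l_n=j$ with $l_m\in\mathbb{Y}_{l_{m-1}}$. Condition D': for $j\in\mathbb{Y}_i$, $p_{ij}(\varepsilon)=\sum_{l=l^-_{ij}}^{l^+_{ij}}a_{ij}[l]\varepsilon^l+o_{ij}(\varepsilon)$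 with integers $0\le l^-_{ij}\le l^+_{ij}$, $a_{ij}[l^-_{ij}]>0$, $|o_{ij}(\varepsilon)|\le G_{ij}\varepsilon^{l^+_{ij}+\delta_{ij}}$ for $0<\varepsilon\le\varepsilon_{ij}$, $\delta_{ij}\in(0,1]$, $G_{ij}\in(0,\infty)$, $\varepsilon_{ij}\in(0,\varepsilon_0]$. Condition E': for $j\in\mathbb{Y}_i$, $e_{ij}(\varepsilon)=\sum_{l=m^-_{ij}}^{m^+_{ij}}b_{ij}[l]\varepsilon^l+\dot o_{ij}(\varepsilon)$ with integers $m^-_{ij}\le m^+_{ij}$, $b_{ij}[m^-_{ij}]>0$, $|\dot o_{ij}(\varepsilon)|\le\dot G_{ij}\varepsilon^{m^+_{ij}+\dot\delta_{ij}}$ for $0<\varepsilon\le\dot\varepsilon_{ij}$, $\dot\delta_{ij}\in(0,1]$, $\dot G_{ij}\in(0,\infty)$, $\dot\varepsilon_{ij}\in(0,\varepsilon_0]$. *)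

theory Defs
  imports "HOL-Probability.Probability"
begin

text \<open>State space X = {1..N}. A (discrete-time) Markov renewal process (eta n, kappa n) on
  a probability space M, started at state i, with semi-Markov kernel Q:
  eta n is the embedded chain, kappa n (n >= 1) the n-th sojourn time, and for every n,
  every sequence of states j 0 = i, j 1, ..., j n in X and every times t 1, ..., t n,
  P(eta 0 = j 0, eta k = j k, kappa k <= t k for 1 <= k <= n) = prod_k Q (j (k-1)) (j k) (t k).\<close>

definition semi_markov_chain ::
  "'a measure \<Rightarrow> (nat \<Rightarrow> 'a \<Rightarrow> nat) \<Rightarrow> (nat \<Rightarrow> 'a \<Rightarrow> real)
    \<Rightarrow> (nat \<Rightarrow> nat \<Rightarrow> real \<Rightarrow> real) \<Rightarrow> nat \<Rightarrow> nat \<Rightarrow> bool" where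
  "semi_markov_chain M \<eta> \<kappa> Q N i \<longleftrightarrow>
     prob_space M \<and>
     (\<forall>n. \<eta> n \<in> measurable M (count_space UNIV)) \<and>
     (\<forall>n. \<kappa> n \<in> borel_measurable M) \<and>
     (\<forall>n \<omega>. \<omega> \<in> space M \<longrightarrow> \<eta> n \<omega> \<in> {1..N}) \<and>
     (\<forall>n \<omega>. \<omega> \<in> space M \<longrightarrow> n \<ge> 1 \<longrightarrow> \<kappa> n \<omega> > 0) \<and>
     (\<forall>n (j::nat \<Rightarrow> nat) (t::nat \<Rightarrow> real).
        j 0 = i \<longrightarrow> (\<forall>k\<le>n. j k \<in> {1..N}) \<longrightarrow>
        measure M {\<omega> \<in> space M. \<forall>k\<le>n. \<eta> k \<omega> = j k \<and> (k \<ge> 1 \<longrightarrow> \<kappa> k \<omega> \<le> t k)}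
          = (\<Prod>k\<in>{1..n}. Q (j (k - 1)) (j k) (t k)))"

definition return_time :: "(nat \<Rightarrow> 'a \<Rightarrow> nat) \<Rightarrow> (nat \<Rightarrow> 'a \<Rightarrow> real) \<Rightarrow> nat \<Rightarrow> 'a \<Rightarrow> real" where
  "return_time \<eta> \<kappa> i \<omega> =
     (let \<nu> = (LEAST n. n \<ge> 1 \<and> \<eta> n \<omega> = i) in \<Sum>k\<in>{1..\<nu>}. \<kappa> k \<omega>)"

definition expected_return_time ::
  "'a measure \<Rightarrow> (nat \<Rightarrow> 'a \<Rightarrow> nat) \<Rightarrow> (nat \<Rightarrow> 'a \<Rightarrow> real) \<Rightarrow> nat \<Rightarrow> real" where
  "expected_return_time M \<eta> \<kappa> i = (\<integral>\<omega>. return_time \<eta> \<kappa> i \<omega> \<partial>M)"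

definition kernel_mean :: "(real \<Rightarrow> real) \<Rightarrow> real" where
  "kernel_mean F = (\<integral>t. t \<partial>(interval_measure F))"

end

theory Submission
  imports Defs "HOL-Library.Landau_Symbols" "HOL-Computational_Algebra.Polynomial"
begin

text \<open>Let \<open>v a\<close> be the expected number of visits to \<open>a\<close> before the return to \<open>i\<close>. Then \<open>v i = 1\<close>,
  \<open>v b = (\<Sum>a. v a * p a b)\<close> for \<open>b \<noteq> i\<close>, and the expected return time is \<open>\<Sum>a b. v a * e a b\<close>.
  Functions whose Laurent expansion has a positive leading coefficient are closed under addition,
  multiplication and division, with the same exponent \<open>\<delta> \<le> 1\<close> in the remainder. It therefore
  suffices to solve the linear system for \<open>v\<close> without subtractions, which is possible since
  \<open>1 - p k k\<close> is the sum of the other entries of row \<open>k\<close>.\<close>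


text \<open>The obstacle is cancellation. Subtracting two expansions may destroy every known term,
  and then neither the order of the difference nor its reciprocal is under control;
  \<open>1 - p k k\<close> is of this kind when \<open>p k k\<close> tends to 1. With positive
  leading coefficients a sum has the smaller of the two orders, and reciprocals exist. The exponent
  \<open>d\<close> does not degrade because all orders are integers: sums, products and reciprocals
  change only the integer part of the exponent of the remainder. The bound \<open>d <= 1\<close>
  lets the first monomial after a truncation count as remainder. Irreducibility enters in three
  places. It makes the expected numbers of visits finite; it yields the row sums of
  \<open>p\<close>, since a row can be read off from path probabilities only after its state has
  been reached; and it provides a pivot with positive leading term at each step of the
  elimination.\<close>

subsection \<open>Pivotal Laurent expansions\<close>

text \<open>The degree of \<open>P\<close> may exceed \<open>m\<close>: as \<open>d \<le> 1\<close>, the remainder absorbs the surplus terms.\<close>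

definition pivotal :: "real \<Rightarrow> (real \<Rightarrow> real) \<Rightarrow> bool" where
  "pivotal d f \<longleftrightarrow> (\<exists>(h::int) (m::nat) P. 0 < coeff P 0 \<and>
     (\<lambda>\<epsilon>. f \<epsilon> - \<epsilon> powr of_int h * poly P \<epsilon>) \<in> O[at_right 0](\<lambda>\<epsilon>. \<epsilon> powr (of_int h + of_nat m + d)))"

section \<open>Powers and polynomials near zero from the right\<close>

lemma eventually_at_right_pos: "\<forall>\<^sub>F \<epsilon> in at_right (0::real). 0 < \<epsilon> \<and> \<epsilon> < 1"
  using eventually_at_right_real[of 0 1] by (auto elim: eventually_mono)

lemma powr_bigo_antimono:
  assumes "b \<le> a" shows "(\<lambda>\<epsilon>. \<epsilon> powr a) \<in> O[at_right 0](\<lambda>\<epsilon>::real. \<epsilon> powr b)"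
  by (intro bigoI[of _ 1] eventually_mono[OF eventually_at_right_pos])
     (use assms in \<open>auto intro: powr_mono'\<close>)

lemma poly_at_right: "((\<lambda>\<epsilon>. poly P \<epsilon>) \<longlongrightarrow> coeff P 0) (at_right (0::real))"
  by (auto intro!: tendsto_eq_intros simp: poly_0_coeff_0)

lemma poly_bigo_1: "(\<lambda>\<epsilon>. poly P \<epsilon>) \<in> O[at_right 0](\<lambda>_::real. 1::real)"
  by (intro bigoI_tendsto[OF _ ]) (use poly_at_right[of P] in auto)

lemma bigo_powr_mult:
  assumes "f \<in> O[at_right 0](\<lambda>\<epsilon>. \<epsilon> powr a)" "g \<in> O[at_right 0](\<lambda>\<epsilon>. \<epsilon> powr b)" "c \<le> a + b"
  shows "(\<lambda>\<epsilon>. f \<epsilon> * g \<epsilon> :: real) \<in> O[at_right 0](\<lambda>\<epsilon>. \<epsilon> powr c)"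
  using landau_o.big_trans[OF landau_o.big.mult[OF assms(1,2), unfolded powr_add[symmetric]]
      powr_bigo_antimono[OF assms(3)]] .

lemma powr_poly_bigo:
  "(\<lambda>\<epsilon>. \<epsilon> powr a * poly P \<epsilon>) \<in> O[at_right 0](\<lambda>\<epsilon>::real. \<epsilon> powr a)"
  using landau_o.big.mult[OF landau_o.big_refl poly_bigo_1, of "\<lambda>\<epsilon>. \<epsilon> powr a"] by simp

lemma bigo_cong_ev:
  assumes "f \<in> O[F](h)" "\<forall>\<^sub>F x in F. f x = g x"
  shows "g \<in> O[F](h)"
  using landau_o.big.in_cong[OF assms(2)] assms(1) by blast

lemma pivotal_cong:
  assumes "\<forall>\<^sub>F \<epsilon> in at_right 0. f \<epsilon> = g \<epsilon>" "pivotal d f"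
  shows "pivotal d g"
proof -
  from assms(2) obtain h m P where *: "0 < coeff P 0"
     "(\<lambda>\<epsilon>. f \<epsilon> - \<epsilon> powr of_int h * poly P \<epsilon>) \<in> O[at_right 0](\<lambda>\<epsilon>. \<epsilon> powr (of_int h + of_nat m + d))"
    unfolding pivotal_def by blast
  have "(\<lambda>\<epsilon>. g \<epsilon> - \<epsilon> powr of_int h * poly P \<epsilon>) \<in> O[at_right 0](\<lambda>\<epsilon>. \<epsilon> powr (of_int h + of_nat m + d))"
    using *(2) by (rule bigo_cong_ev) (use assms(1) in \<open>eventually_elim, simp\<close>)
  with * show ?thesis unfolding pivotal_def by blast
qed

lemma pivotal_bigo:
  fixes f :: "real \<Rightarrow> real" and h :: int and m :: nat
  assumes "(\<lambda>\<epsilon>. f \<epsilon> - \<epsilon> powr of_int h * poly P \<epsilon>) \<in> O[at_right 0](\<lambda>\<epsilon>. \<epsilon> powr (of_int h + of_nat m + d))" "0 < d"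
  shows "f \<in> O[at_right 0](\<lambda>\<epsilon>. \<epsilon> powr (of_int h))"
proof -
  have "(\<lambda>\<epsilon>. (f \<epsilon> - \<epsilon> powr of_int h * poly P \<epsilon>) + \<epsilon> powr of_int h * poly P \<epsilon>)
      \<in> O[at_right 0](\<lambda>\<epsilon>. \<epsilon> powr (of_int h))"
    by (intro sum_in_bigo powr_poly_bigo landau_o.big_trans[OF assms(1) powr_bigo_antimono])
       (use assms(2) in auto)
  then show ?thesis by simp
qed

section \<open>Products, sums and reciprocals of expansions\<close>

lemma pivotal_mult:
  assumes "pivotal d f" "pivotal d g" "0 < d"
  shows "pivotal d (\<lambda>\<epsilon>. f \<epsilon> * g \<epsilon>)"
proof -
  obtain h m P where f: "0 < coeff P 0"
     "(\<lambda>\<epsilon>. f \<epsilon> - \<epsilon> powr of_int h * poly P \<epsilon>) \<in> O[at_right 0](\<lambda>\<epsilon>. \<epsilon> powr (of_int h + of_nat m + d))"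
    using assms(1) unfolding pivotal_def by blast
  obtain k n Q where g: "0 < coeff Q 0"
     "(\<lambda>\<epsilon>. g \<epsilon> - \<epsilon> powr of_int k * poly Q \<epsilon>) \<in> O[at_right 0](\<lambda>\<epsilon>. \<epsilon> powr (of_int k + of_nat n + d))"
    using assms(2) unfolding pivotal_def by blast
  \<comment> \<open>With main terms \<open>F\<close> and \<open>G\<close>,
    \<open>f * g - F * G = (f - F) * g + F * (g - G)\<close>. The less precise factor fixes the
    relative precision \<open>min m n\<close>.\<close>
  have "(\<lambda>\<epsilon>. (f \<epsilon> - \<epsilon> powr of_int h * poly P \<epsilon>) * g \<epsilon>
           + (\<epsilon> powr of_int h * poly P \<epsilon>) * (g \<epsilon> - \<epsilon> powr of_int k * poly Q \<epsilon>))
     \<in> O[at_right 0](\<lambda>\<epsilon>. \<epsilon> powr (of_int (h + k) + of_nat (min m n) + d))"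
    by (intro sum_in_bigo bigo_powr_mult[OF f(2) pivotal_bigo[OF g(2)]]
         bigo_powr_mult[OF powr_poly_bigo g(2)]) (use assms(3) in auto)
  also have "(\<lambda>\<epsilon>. (f \<epsilon> - \<epsilon> powr of_int h * poly P \<epsilon>) * g \<epsilon>
           + (\<epsilon> powr of_int h * poly P \<epsilon>) * (g \<epsilon> - \<epsilon> powr of_int k * poly Q \<epsilon>))
      = (\<lambda>\<epsilon>. f \<epsilon> * g \<epsilon> - \<epsilon> powr of_int (h + k) * poly (P * Q) \<epsilon>)"
    by (auto simp: algebra_simps powr_add)
  finally show ?thesis
    unfolding pivotal_def using f(1) g(1)
    by (intro exI[of _ "h + k"] exI[of _ "min m n"] exI[of _ "P * Q"]) (auto simp: coeff_mult_0)
qed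

lemma pivotal_add:
  assumes "pivotal d f" "pivotal d g" "0 < d" "d \<le> 1"
  shows "pivotal d (\<lambda>\<epsilon>. f \<epsilon> + g \<epsilon>)"
proof -
  \<comment> \<open>It suffices to treat \<open>h <= k\<close>; otherwise the summands are
    exchanged.\<close>
  have *: "pivotal d (\<lambda>\<epsilon>. f \<epsilon> + g \<epsilon>)" if f: "0 < coeff P 0"
     "(\<lambda>\<epsilon>. f \<epsilon> - \<epsilon> powr of_int h * poly P \<epsilon>) \<in> O[at_right 0](\<lambda>\<epsilon>. \<epsilon> powr (of_int h + of_nat m + d))"
     and g: "0 < coeff Q 0"
     "(\<lambda>\<epsilon>. g \<epsilon> - \<epsilon> powr of_int k * poly Q \<epsilon>) \<in> O[at_right 0](\<lambda>\<epsilon>. \<epsilon> powr (of_int k + of_nat n + d))"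
     and "h \<le> k" for f g h k m n P Q
  proof -
    define s where "s = nat (k - h)"
    have k: "k = h + int s" using \<open>h \<le> k\<close> by (auto simp: s_def)
    have "(\<lambda>\<epsilon>. (f \<epsilon> - \<epsilon> powr of_int h * poly P \<epsilon>) + (g \<epsilon> - \<epsilon> powr of_int k * poly Q \<epsilon>))
      \<in> O[at_right 0](\<lambda>\<epsilon>. \<epsilon> powr (of_int h + of_nat (min m (s + n)) + d))" (is "?F \<in> _")
      by (intro sum_in_bigo landau_o.big_trans[OF f(2) powr_bigo_antimono]
           landau_o.big_trans[OF g(2) powr_bigo_antimono]) (auto simp: k)
    moreover have "\<forall>\<^sub>F \<epsilon> in at_right 0. ?F \<epsilon> =
        (f \<epsilon> + g \<epsilon>) - \<epsilon> powr of_int h * poly (P + monom 1 s * Q) \<epsilon>"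
      using eventually_at_right_pos
      by eventually_elim (auto simp: k powr_add powr_realpow poly_monom algebra_simps)
    ultimately have "(\<lambda>\<epsilon>. (f \<epsilon> + g \<epsilon>) - \<epsilon> powr of_int h * poly (P + monom 1 s * Q) \<epsilon>)
      \<in> O[at_right 0](\<lambda>\<epsilon>. \<epsilon> powr (of_int h + of_nat (min m (s + n)) + d))"
      by (rule bigo_cong_ev)
    \<comment> \<open>For \<open>s = 0\<close> the leading coefficients add up, and their positivity
      excludes cancellation; for \<open>s > 0\<close> the one of \<open>P\<close> survives
      alone.\<close>
    moreover have "0 < coeff (P + monom 1 s * Q) 0"
      using f(1) g(1) by (cases s) (auto simp: coeff_mult_0)
    ultimately show ?thesis unfolding pivotal_def by blast
  qed
  obtain h m P where f: "0 < coeff P 0"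
     "(\<lambda>\<epsilon>. f \<epsilon> - \<epsilon> powr of_int h * poly P \<epsilon>) \<in> O[at_right 0](\<lambda>\<epsilon>. \<epsilon> powr (of_int h + of_nat m + d))"
    using assms(1) unfolding pivotal_def by blast
  obtain k n Q where g: "0 < coeff Q 0"
     "(\<lambda>\<epsilon>. g \<epsilon> - \<epsilon> powr of_int k * poly Q \<epsilon>) \<in> O[at_right 0](\<lambda>\<epsilon>. \<epsilon> powr (of_int k + of_nat n + d))"
    using assms(2) unfolding pivotal_def by blast
  show ?thesis
    using *[OF f g] *[OF g f] by (cases "h \<le> k") (auto simp: add.commute)
qed

text \<open>The power series inverse of \<open>P\<close>, truncated: each induction step chooses one
  further coefficient so as to remove the lowest term of the error.\<close>

lemma poly_inverse_approx:
  fixes P :: "real poly"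
  assumes "coeff P 0 \<noteq> 0"
  shows "\<exists>R S. P * R = 1 + monom 1 (Suc m) * S"
proof (induction m)
  case 0
  obtain c Q where P: "P = pCons c Q" by (cases P)
  show ?case
    by (rule exI[of _ "[:1 / c:]"], rule exI[of _ "smult (1 / c) Q"])
       (use assms in \<open>auto simp: P monom_Suc monom_0 one_pCons\<close>)
next
  case (Suc m)
  then obtain R S where RS: "P * R = 1 + monom 1 (Suc m) * S" by blast
  \<comment> \<open>Subtracting \<open>c * X^(m+1)\<close> from \<open>R\<close> turns the error
    \<open>S\<close> into \<open>S - c * P\<close>. This \<open>c\<close> makes its constant term
    vanish, so that one more factor \<open>X\<close> splits off.\<close>
  define c where "c = coeff S 0 / coeff P 0"
  have "coeff (S - smult c P) 0 = 0" using assms by (simp add: c_def)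
  then obtain S' where S': "S - smult c P = monom 1 1 * S'"
    by (cases "S - smult c P") (auto simp: monom_Suc monom_0)
  have "P * (R - monom c (Suc m)) = 1 + monom 1 (Suc m) * (S - smult c P)"
    by (simp add: right_diff_distrib RS smult_monom[of c 1, simplified, symmetric] mult.commute[of P] RS[unfolded mult.commute[of P]] del: smult_monom)
  also have "\<dots> = 1 + monom 1 (Suc (Suc m)) * S'"
    unfolding S' by (simp add: mult.assoc[symmetric] mult_monom)
  finally show ?case by blast
qed

text \<open>As \<open>d > 0\<close>, the remainder is negligible against the leading term. The bound
  is what controls \<open>1 / f\<close> from above.\<close>

lemma pivotal_lower:
  fixes f :: "real \<Rightarrow> real" and h :: int and m :: nat
  assumes "(\<lambda>\<epsilon>. f \<epsilon> - \<epsilon> powr of_int h * poly P \<epsilon>) \<in> O[at_right 0](\<lambda>\<epsilon>. \<epsilon> powr (of_int h + of_nat m + d))"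
    and "0 < d" "0 < coeff P 0"
  shows "\<forall>\<^sub>F \<epsilon> in at_right 0. coeff P 0 / 2 * \<epsilon> powr of_int h \<le> f \<epsilon>"
proof -
  have "(\<lambda>\<epsilon>::real. \<epsilon> powr (of_int h + of_nat m + d)) \<in> o[at_right 0](\<lambda>\<epsilon>. \<epsilon> powr of_int h)"
  proof (rule smalloI_tendsto)
    have "((\<lambda>\<epsilon>::real. \<epsilon> powr (of_nat m + d)) \<longlongrightarrow> 0) (at_right 0)"
      using assms(2) by (intro tendsto_zero_powrI[of _ _ _ "of_nat m + d"])
        (auto intro!: tendsto_intros eventually_mono[OF eventually_at_right_pos])
    then show "((\<lambda>\<epsilon>::real. \<epsilon> powr (of_int h + of_nat m + d) / \<epsilon> powr of_int h) \<longlongrightarrow> 0) (at_right 0)"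
      by (rule Lim_transform_eventually)
        (use eventually_at_right_pos in \<open>eventually_elim, auto simp: powr_add\<close>)
  qed (use eventually_at_right_pos in \<open>eventually_elim, auto\<close>)
  from landau_o.big_small_trans[OF assms(1) this]
  \<comment> \<open>One quarter of the leading coefficient is left to the remainder and one quarter
    to the deviation of \<open>poly P\<close> from its limit; the remaining half is the bound
    claimed.\<close>
  have "\<forall>\<^sub>F \<epsilon> in at_right 0. norm (f \<epsilon> - \<epsilon> powr of_int h * poly P \<epsilon>) \<le> coeff P 0 / 4 * norm (\<epsilon> powr of_int h)"
    using assms(3) by (intro landau_o.smallD) auto
  moreover have "\<forall>\<^sub>F \<epsilon> in at_right 0. 3 / 4 * coeff P 0 < poly P \<epsilon>"
    using order_tendstoD(1)[OF poly_at_right[of P], of "3 / 4 * coeff P 0"] assms(3) by auto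
  ultimately show ?thesis
  proof eventually_elim
    case (elim \<epsilon>)
    have "\<epsilon> powr of_int h * (3 / 4 * coeff P 0) \<le> \<epsilon> powr of_int h * poly P \<epsilon>"
      using elim by (intro mult_left_mono) auto
    moreover have "\<bar>f \<epsilon> - \<epsilon> powr of_int h * poly P \<epsilon>\<bar> \<le> 1 / 4 * (\<epsilon> powr of_int h * coeff P 0)"
      using elim(1) by (simp add: mult.commute)
    ultimately show ?case by argo
  qed
qed

lemma pivotal_pos:
  assumes "pivotal d f" "0 < d"
  shows "\<forall>\<^sub>F \<epsilon> in at_right 0. 0 < f \<epsilon>"
proof -
  obtain h m P where f: "0 < coeff P 0"
     "(\<lambda>\<epsilon>. f \<epsilon> - \<epsilon> powr of_int h * poly P \<epsilon>) \<in> O[at_right 0](\<lambda>\<epsilon>. \<epsilon> powr (of_int h + of_nat m + d))"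
    using assms(1) unfolding pivotal_def by blast
  from pivotal_lower[OF f(2) assms(2) f(1)] eventually_at_right_pos show ?thesis
  proof eventually_elim
    case (elim \<epsilon>)
    then have "0 < coeff P 0 / 2 * \<epsilon> powr of_int h" using f(1) by auto
    with elim show ?case by linarith
  qed
qed

text \<open>Let \<open>F\<close> be the main term of \<open>f\<close> and
  \<open>P * R = 1 + X^(m+1) * S\<close>. Then \<open>1 - f * \<epsilon>^(-h) * R = - (f - F) *
  \<epsilon>^(-h) * R - \<epsilon>^(m+1) * S\<close>, and division by \<open>f\<close> gives the
  remainder of \<open>1 / f\<close>.\<close>

lemma pivotal_inverse:
  assumes "pivotal d f" "0 < d" "d \<le> 1"
  shows "pivotal d (\<lambda>\<epsilon>. 1 / f \<epsilon>)"
proof -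
  obtain h m P where f: "0 < coeff P 0"
     "(\<lambda>\<epsilon>. f \<epsilon> - \<epsilon> powr of_int h * poly P \<epsilon>) \<in> O[at_right 0](\<lambda>\<epsilon>. \<epsilon> powr (of_int h + of_nat m + d))"
    using assms(1) unfolding pivotal_def by blast
  obtain R S where RS: "P * R = 1 + monom 1 (Suc m) * S"
    using poly_inverse_approx f(1) by (metis less_irrefl)
  have "coeff P 0 * coeff R 0 = 1"
    using arg_cong[OF RS, of "\<lambda>p. coeff p 0"] by (simp add: coeff_mult_0)
  then have R0: "0 < coeff R 0" using f(1) by (metis zero_less_mult_pos zero_less_one)
  have inv: "(\<lambda>\<epsilon>. 1 / f \<epsilon>) \<in> O[at_right 0](\<lambda>\<epsilon>. \<epsilon> powr (- of_int h))"
  proof (rule bigoI[of _ "2 / coeff P 0"])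
    show "\<forall>\<^sub>F \<epsilon> in at_right 0. norm (1 / f \<epsilon>) \<le> 2 / coeff P 0 * norm (\<epsilon> powr - real_of_int h)"
      using pivotal_lower[OF f(2) assms(2) f(1)] eventually_at_right_pos
    proof eventually_elim
      case (elim \<epsilon>)
      have *: "0 < coeff P 0 / 2 * \<epsilon> powr of_int h" using f(1) elim by auto
      then have pos: "0 < f \<epsilon>" using elim by linarith
      have "1 / f \<epsilon> \<le> 1 / (coeff P 0 / 2 * \<epsilon> powr of_int h)"
        using elim(1) * pos by (intro divide_left_mono mult_pos_pos[OF pos *]) auto
      with pos show ?case by (simp add: powr_minus field_simps)
    qed
  qed
  \<comment> \<open>Both summands are of order \<open>m + d\<close>, the second one because
    \<open>d <= 1\<close>.\<close>
  have "(\<lambda>\<epsilon>. - ((f \<epsilon> - \<epsilon> powr of_int h * poly P \<epsilon>) * (\<epsilon> powr of_int (- h) * poly R \<epsilon>))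
        - \<epsilon> powr of_nat (Suc m) * poly S \<epsilon>) \<in> O[at_right 0](\<lambda>\<epsilon>. \<epsilon> powr (of_nat m + d))"
    by (intro sum_in_bigo landau_o.big_trans[OF powr_poly_bigo powr_bigo_antimono]
          landau_o.big.uminus_in_iff[THEN iffD2]
          bigo_powr_mult[OF f(2) powr_poly_bigo]) (use assms in auto)
  from bigo_powr_mult[OF this inv order.refl]
  have "(\<lambda>\<epsilon>. (- ((f \<epsilon> - \<epsilon> powr of_int h * poly P \<epsilon>) * (\<epsilon> powr of_int (- h) * poly R \<epsilon>))
        - \<epsilon> powr of_nat (Suc m) * poly S \<epsilon>) * (1 / f \<epsilon>))
      \<in> O[at_right 0](\<lambda>\<epsilon>. \<epsilon> powr (of_int (- h) + of_nat m + d))" (is "?F \<in> _")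
    by (simp add: add.commute add.left_commute)
  moreover have "\<forall>\<^sub>F \<epsilon> in at_right 0. ?F \<epsilon> = 1 / f \<epsilon> - \<epsilon> powr of_int (- h) * poly R \<epsilon>"
    using eventually_at_right_pos pivotal_pos[OF assms(1,2)]
  proof eventually_elim
    case (elim \<epsilon>)
    have PR: "poly P \<epsilon> * poly R \<epsilon> = 1 + \<epsilon> ^ Suc m * poly S \<epsilon>"
      using arg_cong[OF RS, of "\<lambda>p. poly p \<epsilon>"] by (simp add: poly_monom)
    have hh: "\<epsilon> powr of_int h * \<epsilon> powr of_int (- h) = 1" using elim by (simp flip: powr_add)
    have "- ((f \<epsilon> - \<epsilon> powr of_int h * poly P \<epsilon>) * (\<epsilon> powr of_int (- h) * poly R \<epsilon>))
        = - f \<epsilon> * (\<epsilon> powr of_int (- h) * poly R \<epsilon>) +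
         (\<epsilon> powr of_int h * \<epsilon> powr of_int (- h)) * (poly P \<epsilon> * poly R \<epsilon>)"
      by (simp add: algebra_simps)
    then have "- ((f \<epsilon> - \<epsilon> powr of_int h * poly P \<epsilon>) * (\<epsilon> powr of_int (- h) * poly R \<epsilon>))
        - \<epsilon> powr of_nat (Suc m) * poly S \<epsilon> = 1 - f \<epsilon> * (\<epsilon> powr of_int (- h) * poly R \<epsilon>)"
      unfolding hh PR using elim by (simp only: powr_realpow) simp
    then show ?case using elim by (simp add: field_simps)
  qed
  ultimately have "(\<lambda>\<epsilon>. 1 / f \<epsilon> - \<epsilon> powr of_int (- h) * poly R \<epsilon>)
      \<in> O[at_right 0](\<lambda>\<epsilon>. \<epsilon> powr (of_int (- h) + of_nat m + d))"
    by (rule bigo_cong_ev)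
  with R0 show ?thesis unfolding pivotal_def by blast
qed


text \<open>Transitions outside \<open>Y\<close> have probability zero, and for \<open>d > 0\<close>
  the zero function has no expansion with positive leading coefficient. With this alternative all
  entries of the linear system belong to one class that is closed under sums and products.\<close>

definition pivotal0 :: "real \<Rightarrow> (real \<Rightarrow> real) \<Rightarrow> bool" where
  "pivotal0 d f \<longleftrightarrow> (\<forall>\<^sub>F \<epsilon> in at_right 0. f \<epsilon> = 0) \<or> pivotal d f"

lemma pivotal0_cong:
  assumes "\<forall>\<^sub>F \<epsilon> in at_right 0. f \<epsilon> = g \<epsilon>" "pivotal0 d f"
  shows "pivotal0 d g"
proof (cases "pivotal d f")
  case True
  then show ?thesis using pivotal_cong[OF assms(1)] by (simp add: pivotal0_def)
next
  case False
  with assms(2) have "\<forall>\<^sub>F \<epsilon> in at_right 0. f \<epsilon> = 0" by (simp add: pivotal0_def)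
  with assms(1) have "\<forall>\<^sub>F \<epsilon> in at_right 0. g \<epsilon> = 0" by eventually_elim simp
  then show ?thesis by (simp add: pivotal0_def)
qed

lemma pivotal0_mult:
  assumes "pivotal0 d f" "pivotal0 d g" "0 < d"
  shows "pivotal0 d (\<lambda>\<epsilon>. f \<epsilon> * g \<epsilon>)"
  using assms pivotal_mult unfolding pivotal0_def
  by (auto elim: eventually_mono)

lemma pivotal_add_pivotal0:
  assumes "pivotal d f" "pivotal0 d g" "0 < d" "d \<le> 1"
  shows "pivotal d (\<lambda>\<epsilon>. f \<epsilon> + g \<epsilon>)"
  using assms(2) pivotal_add[OF assms(1) _ assms(3,4)] unfolding pivotal0_def
  by (auto intro: pivotal_cong[OF _ assms(1)] elim: eventually_mono)

lemma pivotal0_add: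
  assumes "pivotal0 d f" "pivotal0 d g" "0 < d" "d \<le> 1"
  shows "pivotal0 d (\<lambda>\<epsilon>. f \<epsilon> + g \<epsilon>)"
proof (cases "pivotal d f")
  case True
  then show ?thesis using pivotal_add_pivotal0[OF True assms(2-4)] by (simp add: pivotal0_def)
next
  case False
  with assms(1) have "\<forall>\<^sub>F \<epsilon> in at_right 0. f \<epsilon> = 0" by (simp add: pivotal0_def)
  then show ?thesis by (intro pivotal0_cong[OF _ assms(2)]) (auto elim: eventually_mono)
qed

lemma pivotal0_sum:
  assumes "finite A" "\<And>a. a \<in> A \<Longrightarrow> pivotal0 d (f a)" "0 < d" "d \<le> 1"
  shows "pivotal0 d (\<lambda>\<epsilon>. \<Sum>a\<in>A. f a \<epsilon>)"
  using assms(1,2)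
proof (induction A rule: finite_induct)
  case empty
  then show ?case by (simp add: pivotal0_def)
next
  case (insert x A)
  then show ?case by (auto intro!: pivotal0_add[OF _ _ assms(3,4)])
qed

text \<open>One summand with a positive leading term is enough, since the others cannot cancel
  it.\<close>

lemma pivotal_sum:
  assumes "finite A" "\<And>a. a \<in> A \<Longrightarrow> pivotal0 d (f a)" "0 < d" "d \<le> 1"
    and "b \<in> A" "pivotal d (f b)"
  shows "pivotal d (\<lambda>\<epsilon>. \<Sum>a\<in>A. f a \<epsilon>)"
  using pivotal_add_pivotal0[OF assms(6) pivotal0_sum[of "A - {b}" d f, OF _ _ assms(3,4)] assms(3,4)]
    assms by (simp add: sum.remove[of A b])

text \<open>Gaussian elimination without subtractions: since the rows of the system sum to one together
  with the exit weights \<open>r\<close>, the pivot \<open>1 - q k k\<close> equals a sum of the remaining entries of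
  row \<open>k\<close>. The last hypothesis says that every set of states can be left.\<close>

lemma pivotal0_solution:
  fixes S :: "'s set" and q :: "'s \<Rightarrow> 's \<Rightarrow> real \<Rightarrow> real"
  assumes "finite S" "0 < d" "d \<le> 1"
    and "\<And>k j. k \<in> S \<Longrightarrow> j \<in> S \<Longrightarrow> pivotal0 d (q k j)"
    and "\<And>k. k \<in> S \<Longrightarrow> pivotal0 d (r k)"
    and "\<And>j. j \<in> S \<Longrightarrow> pivotal0 d (s j)"
    and "\<And>k. k \<in> S \<Longrightarrow> \<forall>\<^sub>F \<epsilon> in at_right 0. (\<Sum>j\<in>S. q k j \<epsilon>) + r k \<epsilon> = 1"
    and "\<And>j. j \<in> S \<Longrightarrow> \<forall>\<^sub>F \<epsilon> in at_right 0. x j \<epsilon> = s j \<epsilon> + (\<Sum>k\<in>S. x k \<epsilon> * q k j \<epsilon>)"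
    and "\<And>T. T \<subseteq> S \<Longrightarrow> T \<noteq> {} \<Longrightarrow> \<exists>k\<in>T. pivotal d (r k) \<or> (\<exists>j\<in>S - T. pivotal d (q k j))"
    and "j \<in> S"
  shows "pivotal0 d (x j)"
  using assms(1,4-)
proof (induction S arbitrary: q r s j rule: finite_induct)
  case empty
  then show ?case by simp
next
  case (insert k S)
  note d = \<open>0 < d\<close> \<open>d \<le> 1\<close>
  note q = insert.prems(1) and r = insert.prems(2) and s = insert.prems(3)
    and row = insert.prems(4) and eq = insert.prems(5) and leak = insert.prems(6)
  \<comment> \<open>The states are now \<open>insert k S\<close>, so \<open>D\<close> is row
    \<open>k\<close> without its diagonal entry: the pivot \<open>1 - q k k\<close> in a form free
    of subtraction.\<close>
  define D where "D \<epsilon> = (\<Sum>j\<in>S. q k j \<epsilon>) + r k \<epsilon>" for \<epsilon>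
  have "pivotal d D"
  proof -
    \<comment> \<open>The set \<open>{k}\<close> can be left, so some summand of \<open>D\<close> is
      pivotal, and \<open>D\<close> can be inverted.\<close>
    from leak[of "{k}"] insert.hyps consider "pivotal d (r k)" | j where "j \<in> S" "pivotal d (q k j)"
      by auto
    then show ?thesis
    proof cases
      case 1
      have "pivotal d (\<lambda>\<epsilon>. r k \<epsilon> + (\<Sum>j\<in>S. q k j \<epsilon>))"
        by (intro pivotal_add_pivotal0[OF 1 pivotal0_sum[OF _ _ d] d]) (use insert.hyps q in auto)
      then show ?thesis by (simp add: D_def[abs_def] add.commute)
    next
      case 2
      have "pivotal d (\<lambda>\<epsilon>. \<Sum>j\<in>S. q k j \<epsilon>)"
        by (rule pivotal_sum[where f = "q k" and b = j]) (use insert.hyps q d 2 in auto)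
      then show ?thesis unfolding D_def[abs_def]
        by (rule pivotal_add_pivotal0) (use r d in auto)
    qed
  qed
  then have Dinv: "pivotal d (\<lambda>\<epsilon>. 1 / D \<epsilon>)" and Dpos: "\<forall>\<^sub>F \<epsilon> in at_right 0. 0 < D \<epsilon>"
    using pivotal_inverse pivotal_pos d by auto
  then have Dinv0: "pivotal0 d (\<lambda>\<epsilon>. 1 / D \<epsilon>)" by (simp add: pivotal0_def)
  have pivot: "\<forall>\<^sub>F \<epsilon> in at_right 0. q k k \<epsilon> = 1 - D \<epsilon>"
    using row[of k] insert.hyps by (auto simp: D_def elim: eventually_mono)
  \<comment> \<open>The system after substitution of \<open>x k\<close>. In terms of chains it
    belongs to the process observed only outside \<open>k\<close>; the factor \<open>1 / D\<close>
    sums the geometric series of repeated steps from \<open>k\<close> to itself.\<close>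
  define q' where "q' l j \<epsilon> = q l j \<epsilon> + q l k \<epsilon> * q k j \<epsilon> * (1 / D \<epsilon>)" for l j \<epsilon>
  define r' where "r' l \<epsilon> = r l \<epsilon> + q l k \<epsilon> * r k \<epsilon> * (1 / D \<epsilon>)" for l \<epsilon>
  define s' where "s' j \<epsilon> = s j \<epsilon> + s k \<epsilon> * q k j \<epsilon> * (1 / D \<epsilon>)" for j \<epsilon>
  have xk: "\<forall>\<^sub>F \<epsilon> in at_right 0. x k \<epsilon> = (s k \<epsilon> + (\<Sum>l\<in>S. x l \<epsilon> * q l k \<epsilon>)) * (1 / D \<epsilon>)"
    using eq[of k, simplified] pivot Dpos
  proof eventually_elim
    case (elim \<epsilon>)
    then show ?case using insert.hyps by (simp add: field_simps)
  qed
  have IH: "pivotal0 d (x j)" if "j \<in> S" for j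
  proof (rule insert.IH[of q' r' s'])
    fix l j assume "l \<in> S" "j \<in> S"
    then show "pivotal0 d (q' l j)" unfolding q'_def[abs_def]
      by (intro pivotal0_add pivotal0_mult q Dinv0 d) auto
  next
    fix l assume l: "l \<in> S"
    then show "pivotal0 d (r' l)" unfolding r'_def[abs_def]
      by (intro pivotal0_add pivotal0_mult q r Dinv0 d) auto
    show "pivotal0 d (s' l)" unfolding s'_def[abs_def] using l
      by (intro pivotal0_add pivotal0_mult q s Dinv0 d) auto
    show "\<forall>\<^sub>F \<epsilon> in at_right 0. (\<Sum>j\<in>S. q' l j \<epsilon>) + r' l \<epsilon> = 1"
      using row[of l, OF insertI2[OF l]] Dpos
    proof eventually_elim
      case (elim \<epsilon>)
      \<comment> \<open>The mass \<open>q l k\<close> that entered \<open>k\<close> is passed on in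
        the proportions \<open>q k j / D\<close> and \<open>r k / D\<close>, which sum to
        one.\<close>
      have "(\<Sum>j\<in>S. q' l j \<epsilon>) + r' l \<epsilon>
         = (\<Sum>j\<in>S. q l j \<epsilon>) + r l \<epsilon> + q l k \<epsilon> * D \<epsilon> * (1 / D \<epsilon>)"
        by (simp add: q'_def r'_def D_def sum.distrib sum_distrib_left sum_distrib_right
            distrib_left distrib_right add_divide_distrib sum_divide_distrib)
      then show ?case using elim insert.hyps by simp
    qed
    show "\<forall>\<^sub>F \<epsilon> in at_right 0. x l \<epsilon> = s' l \<epsilon> + (\<Sum>k\<in>S. x k \<epsilon> * q' k l \<epsilon>)"
      using eq[of l, OF insertI2[OF l]] xk
    proof eventually_elim
      case (elim \<epsilon>)
      have "x l \<epsilon> = s l \<epsilon> + x k \<epsilon> * q k l \<epsilon> + (\<Sum>m\<in>S. x m \<epsilon> * q m l \<epsilon>)"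
        using elim(1) insert.hyps by simp
      also have "x k \<epsilon> * q k l \<epsilon> = s k \<epsilon> * q k l \<epsilon> * (1 / D \<epsilon>)
          + (\<Sum>m\<in>S. x m \<epsilon> * (q m k \<epsilon> * q k l \<epsilon> * (1 / D \<epsilon>)))"
        unfolding elim(2)
        by (simp add: distrib_left distrib_right sum_distrib_right sum_distrib_left sum_divide_distrib
             add_divide_distrib mult_ac)
      finally show ?case by (simp add: q'_def s'_def distrib_left sum.distrib)
    qed
  next
    fix T assume T: "T \<subseteq> S" "T \<noteq> {}"
    show "\<exists>l\<in>T. pivotal d (r' l) \<or> (\<exists>j\<in>S - T. pivotal d (q' l j))"
    \<comment> \<open>An exit of \<open>T\<close> that avoids \<open>k\<close> survives, because the
      terms added by the elimination cannot cancel it.\<close>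
    proof (cases "\<exists>l\<in>T. pivotal d (r l) \<or> (\<exists>j\<in>S - T. pivotal d (q l j))")
      case True
      then obtain l where l: "l \<in> T" "pivotal d (r l) \<or> (\<exists>j\<in>S - T. pivotal d (q l j))" by blast
      have "pivotal d (r' l)" if "pivotal d (r l)"
        unfolding r'_def[abs_def] using l T
        by (intro pivotal_add_pivotal0 pivotal0_mult that q r Dinv0 d) auto
      moreover have "pivotal d (q' l j)" if "pivotal d (q l j)" "j \<in> S - T" for j
        unfolding q'_def[abs_def] using l T that(2)
        by (intro pivotal_add_pivotal0 pivotal0_mult that(1) q r Dinv0 d) auto
      ultimately show ?thesis using l by blast
    next
      case False
      \<comment> \<open>Now \<open>T\<close> can be left only towards \<open>k\<close>, and since
        \<open>insert k T\<close> can be left as well, \<open>k\<close> has an exit of its own. The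
        detour through \<open>k\<close> is a product of pivotal factors and has become a direct
        entry of the new system.\<close>
      obtain l where l: "l \<in> T" "pivotal d (q l k)"
        using leak[of T] T False insert.hyps by auto
      have "pivotal d (r k) \<or> (\<exists>j\<in>S - T. pivotal d (q k j))"
        using leak[of "insert k T"] T False insert.hyps by auto
      moreover have "pivotal d (r' l)" if "pivotal d (r k)"
      proof -
        have "pivotal d (\<lambda>\<epsilon>. q l k \<epsilon> * r k \<epsilon> * (1 / D \<epsilon>) + r l \<epsilon>)"
          using l T by (intro pivotal_add_pivotal0 pivotal_mult that r Dinv d l(2)) auto
        then show ?thesis by (simp add: r'_def[abs_def] add.commute)
      qed
      moreover have "pivotal d (q' l j)" if "pivotal d (q k j)" "j \<in> S - T" for j
      proof -
        have "pivotal d (\<lambda>\<epsilon>. q l k \<epsilon> * q k j \<epsilon> * (1 / D \<epsilon>) + q l j \<epsilon>)"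
          using l T that(2) by (intro pivotal_add_pivotal0 pivotal_mult that(1) q Dinv d l(2)) auto
        then show ?thesis by (simp add: q'_def[abs_def] add.commute)
      qed
      ultimately show ?thesis using l by blast
    qed
  qed (use that in auto)
  show ?case
  proof (cases "j = k")
    case True
    \<comment> \<open>Back substitution: \<open>x k\<close> is expressed by the unknowns already
      treated.\<close>
    have "pivotal0 d (\<lambda>\<epsilon>. (s k \<epsilon> + (\<Sum>l\<in>S. x l \<epsilon> * q l k \<epsilon>)) * (1 / D \<epsilon>))"
      using insert.hyps by (intro pivotal0_mult pivotal0_add pivotal0_sum Dinv0 d IH q s) auto
    then show ?thesis unfolding True
      by (rule pivotal0_cong[rotated]) (use xk in \<open>eventually_elim, simp\<close>)
  qed (use IH insert.prems in auto)
qed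

section \<open>Translation from and to explicit Laurent sums\<close>

lemma pivotalI_laurent:
  fixes l u :: int and e c C :: real
  assumes "l \<le> u" "0 < a l" "0 < c" "d \<le> e"
    and "\<And>\<epsilon>. 0 < \<epsilon> \<Longrightarrow> \<epsilon> \<le> c \<Longrightarrow>
      \<bar>f \<epsilon> - (\<Sum>n\<in>{l..u}. a n * \<epsilon> powi n)\<bar> \<le> C * \<epsilon> powr (of_int u + e)"
  shows "pivotal d f"
proof -
  define m where "m = nat (u - l)"
  define P where "P = (\<Sum>n\<le>m. monom (a (l + int n)) n)"
  have u: "u = l + int m" using assms(1) by (simp add: m_def)
  have P: "(\<Sum>n\<in>{l..u}. a n * \<epsilon> powi n) = \<epsilon> powr of_int l * poly P \<epsilon>" if "0 < \<epsilon>" for \<epsilon>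
  proof -
    have "(\<Sum>n\<in>{l..u}. a n * \<epsilon> powi n) = (\<Sum>n\<le>m. a (l + int n) * \<epsilon> powi (l + int n))"
      by (rule sum.reindex_bij_witness[of _ "\<lambda>n. l + int n" "\<lambda>n. nat (n - l)"]) (auto simp: u)
    also have "\<dots> = \<epsilon> powr of_int l * poly P \<epsilon>"
      using that by (simp add: P_def poly_sum poly_monom sum_distrib_left power_int_add
          powr_real_of_int' mult_ac)
    finally show ?thesis .
  qed
  have "coeff P 0 = (\<Sum>n\<le>m. if n = 0 then a (l + int n) else 0)"
    by (simp add: P_def coeff_sum)
  also have "\<dots> = a l" by (subst sum.delta) auto
  finally have "0 < coeff P 0" using assms(2) by simp
  moreover have "(\<lambda>\<epsilon>. f \<epsilon> - \<epsilon> powr of_int l * poly P \<epsilon>)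
      \<in> O[at_right 0](\<lambda>\<epsilon>. \<epsilon> powr (of_int u + e))"
    using assms(3,5) eventually_at_right_real[of 0 c]
    by (intro bigoI[of _ C]) (auto elim!: eventually_mono simp flip: P)
  \<comment> \<open>Weakening the individual exponent \<open>e\<close> to \<open>d\<close> gives all
    given expansions one common exponent.\<close>
  from landau_o.big_trans[OF this powr_bigo_antimono[of "of_int l + of_nat m + d"]]
  have "(\<lambda>\<epsilon>. f \<epsilon> - \<epsilon> powr of_int l * poly P \<epsilon>)
      \<in> O[at_right 0](\<lambda>\<epsilon>. \<epsilon> powr (of_int l + of_nat m + d))"
    using assms(4) by (simp add: u)
  ultimately show ?thesis unfolding pivotal_def by blast
qed

lemma pivotalE_laurent:
  assumes "pivotal d f" "0 < d" "d \<le> 1" "0 < e"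
  obtains l u :: int and a :: "int \<Rightarrow> real" and C c :: real
  where "l \<le> u" "0 < a l" "0 < C" "0 < c" "c \<le> e"
    "\<And>\<epsilon>. 0 < \<epsilon> \<Longrightarrow> \<epsilon> \<le> c \<Longrightarrow>
      \<bar>f \<epsilon> - (\<Sum>n\<in>{l..u}. a n * \<epsilon> powi n)\<bar> \<le> C * \<epsilon> powr (of_int u + d)"
proof -
  obtain h m P where f: "0 < coeff P 0"
     "(\<lambda>\<epsilon>. f \<epsilon> - \<epsilon> powr of_int h * poly P \<epsilon>) \<in> O[at_right 0](\<lambda>\<epsilon>. \<epsilon> powr (of_int h + of_nat m + d))"
    using assms(1) unfolding pivotal_def by blast
  define a where "a n = coeff P (nat (n - h))" for n
  define u where "u = h + int m"
  \<comment> \<open>\<open>R\<close> collects the terms of \<open>P\<close> beyond degree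
    \<open>m\<close>. They contribute order \<open>u + 1\<close>, which is within the remainder
    because \<open>d <= 1\<close>.\<close>
  define R where "R = poly_shift (Suc m) P"
  define L where "L = (\<Sum>n\<le>m. monom (coeff P n) n)"
  have P: "P = L + monom 1 (Suc m) * R"
    by (rule poly_eqI) (auto simp: L_def R_def coeff_sum coeff_poly_shift coeff_monom_mult)
  have sum: "(\<Sum>n\<in>{h..u}. a n * \<epsilon> powi n) = \<epsilon> powr of_int h * poly L \<epsilon>"
    if "0 < \<epsilon>" for \<epsilon>
  proof -
    have "(\<Sum>n\<in>{h..u}. a n * \<epsilon> powi n) = (\<Sum>n\<le>m. a (h + int n) * \<epsilon> powi (h + int n))"
      by (rule sum.reindex_bij_witness[of _ "\<lambda>n. h + int n" "\<lambda>n. nat (n - h)"]) (auto simp: u_def)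
    also have "\<dots> = \<epsilon> powr of_int h * poly L \<epsilon>"
      using that by (simp add: L_def poly_sum poly_monom a_def sum_distrib_left power_int_add
          powr_real_of_int' mult_ac)
    finally show ?thesis .
  qed
  have "(\<lambda>\<epsilon>. (f \<epsilon> - \<epsilon> powr of_int h * poly P \<epsilon>) + \<epsilon> powr of_int (h + int (Suc m)) * poly R \<epsilon>)
      \<in> O[at_right 0](\<lambda>\<epsilon>. \<epsilon> powr (of_int u + d))" (is "?F \<in> _")
    by (intro sum_in_bigo(1) landau_o.big_trans[OF powr_poly_bigo powr_bigo_antimono])
       (use f(2) assms in \<open>auto simp: u_def\<close>)
  moreover have "\<forall>\<^sub>F \<epsilon> in at_right 0. ?F \<epsilon> = f \<epsilon> - (\<Sum>n\<in>{h..u}. a n * \<epsilon> powi n)"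
    using eventually_at_right_pos
  proof eventually_elim
    case (elim \<epsilon>)
    have "poly P \<epsilon> = poly L \<epsilon> + \<epsilon> ^ Suc m * poly R \<epsilon>"
      using arg_cong[OF P, of "\<lambda>p. poly p \<epsilon>"] by (simp add: poly_monom)
    moreover have "\<epsilon> powr of_int (h + int (Suc m)) = \<epsilon> powr of_int h * \<epsilon> ^ Suc m"
      using elim by (simp add: powr_real_of_int' power_int_add del: of_int_add)
    ultimately show ?case using elim by (simp only: sum) (simp add: algebra_simps)
  qed
  ultimately have "(\<lambda>\<epsilon>. f \<epsilon> - (\<Sum>n\<in>{h..u}. a n * \<epsilon> powi n)) \<in> O[at_right 0](\<lambda>\<epsilon>. \<epsilon> powr (of_int u + d))"
    by (rule bigo_cong_ev)
  then obtain C where C: "0 < C"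
    "\<forall>\<^sub>F \<epsilon> in at_right 0. norm (f \<epsilon> - (\<Sum>n\<in>{h..u}. a n * \<epsilon> powi n)) \<le> C * norm (\<epsilon> powr (of_int u + d))"
    by (rule landau_o.bigE)
  then obtain c where c: "0 < c" "\<And>\<epsilon>. 0 < \<epsilon> \<Longrightarrow> \<epsilon> < c \<Longrightarrow>
      \<bar>f \<epsilon> - (\<Sum>n\<in>{h..u}. a n * \<epsilon> powi n)\<bar> \<le> C * \<epsilon> powr (of_int u + d)"
    unfolding eventually_at_right_field by auto
  \<comment> \<open>Halving turns the strict bound \<open>\<epsilon> < c\<close> into a closed one;
    the minimum keeps the range below the prescribed \<open>e\<close>.\<close>
  show ?thesis
    by (rule that[of h u a C "min (c / 2) e"]) (use f(1) C(1) c assms in \<open>auto simp: u_def a_def\<close>)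
qed

subsection \<open>The expected return time of a semi-Markov chain\<close>

text \<open>One fixed value of the parameter. The identities obtained here are exact, and
  asymptotics enter only when the parameter varies.\<close>

locale semi_markov =
  fixes M :: "'a measure" and \<eta> :: "nat \<Rightarrow> 'a \<Rightarrow> nat" and \<kappa> :: "nat \<Rightarrow> 'a \<Rightarrow> real"
    and Q :: "nat \<Rightarrow> nat \<Rightarrow> real \<Rightarrow> real" and p :: "nat \<Rightarrow> nat \<Rightarrow> real"
    and N i :: nat and Y :: "nat \<Rightarrow> nat set"
  assumes chain: "semi_markov_chain M \<eta> \<kappa> Q N i"
    and i_in: "i \<in> {1..N}"
    and Q_mono: "\<And>k j. k \<in> {1..N} \<Longrightarrow> j \<in> {1..N} \<Longrightarrow> mono (Q k j)"
    and Q_rcont: "\<And>k j t. k \<in> {1..N} \<Longrightarrow> j \<in> {1..N} \<Longrightarrow> continuous (at_right t) (Q k j)"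
    and Q_zero: "\<And>k j t. k \<in> {1..N} \<Longrightarrow> j \<in> {1..N} \<Longrightarrow> t \<le> 0 \<Longrightarrow> Q k j t = 0"
    and Q_p: "\<And>k j. k \<in> {1..N} \<Longrightarrow> j \<in> {1..N} \<Longrightarrow> (Q k j \<longlongrightarrow> p k j) at_top"
    and e_fin: "\<And>k j. k \<in> {1..N} \<Longrightarrow> j \<in> {1..N} \<Longrightarrow> integrable (interval_measure (Q k j)) (\<lambda>t. t)"
    and Y_sub: "\<And>k. k \<in> {1..N} \<Longrightarrow> Y k \<subseteq> {1..N}"
    and p_pos: "\<And>k j. k \<in> {1..N} \<Longrightarrow> j \<in> Y k \<Longrightarrow> p k j > 0"
    and p_zero: "\<And>k j. k \<in> {1..N} \<Longrightarrow> j \<in> {1..N} \<Longrightarrow> j \<notin> Y k \<Longrightarrow> p k j = 0"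
    and irreducible: "\<And>k j. k \<in> {1..N} \<Longrightarrow> j \<in> {1..N} \<Longrightarrow>
        \<exists>n\<ge>1. \<exists>l::nat \<Rightarrow> nat. l 0 = k \<and> l n = j \<and> (\<forall>m\<in>{1..n}. l m \<in> Y (l (m - 1)))"
begin

sublocale prob_space M
  using chain unfolding semi_markov_chain_def by blast

section \<open>Probabilities of finite paths\<close>

lemma \<eta>_measurable [measurable]: "\<eta> n \<in> measurable M (count_space UNIV)"
  and \<kappa>_measurable [measurable]: "\<kappa> n \<in> borel_measurable M"
  and \<eta>_in: "\<omega> \<in> space M \<Longrightarrow> \<eta> n \<omega> \<in> {1..N}"
  and \<kappa>_pos: "\<omega> \<in> space M \<Longrightarrow> 1 \<le> n \<Longrightarrow> 0 < \<kappa> n \<omega>"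
  and path_prob: "j 0 = i \<Longrightarrow> (\<And>k. k \<le> n \<Longrightarrow> j k \<in> {1..N}) \<Longrightarrow>
     prob {\<omega> \<in> space M. \<forall>k\<le>n. \<eta> k \<omega> = j k \<and> (k \<ge> 1 \<longrightarrow> \<kappa> k \<omega> \<le> t k)}
          = (\<Prod>k\<in>{1..n}. Q (j (k - 1)) (j k) (t k))"
  using chain unfolding semi_markov_chain_def by blast+

lemma Q_nonneg: "0 \<le> Q k j t" if "k \<in> {1..N}" "j \<in> {1..N}"
  using monoD[OF Q_mono[OF that], of "min t 0" t] Q_zero[OF that, of "min t 0"] by simp

lemma Q_seq: "(\<lambda>m. Q k j (real m)) \<longlonglongrightarrow> p k j" if "k \<in> {1..N}" "j \<in> {1..N}"
  using Q_p[OF that] filterlim_real_sequentially by (rule filterlim_compose)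

lemma p_nonneg: "0 \<le> p k j" if "k \<in> {1..N}" "j \<in> {1..N}"
  using p_pos[OF that(1)] p_zero[OF that] by (metis less_imp_le order.refl)

text \<open>\<open>path_prob\<close> bounds every sojourn time. Letting all bounds but the last tend
  to infinity turns their factors \<open>Q\<close> into \<open>p\<close>, by continuity from
  below.\<close>

lemma path_prob_last:
  assumes "j 0 = i" "\<And>k. k \<le> Suc n \<Longrightarrow> j k \<in> {1..N}"
  shows "prob {\<omega> \<in> space M. (\<forall>k\<le>Suc n. \<eta> k \<omega> = j k) \<and> \<kappa> (Suc n) \<omega> \<le> t}
     = (\<Prod>k\<in>{1..n}. p (j (k - 1)) (j k)) * Q (j n) (j (Suc n)) t"
proof (rule LIMSEQ_unique)
  define T where "T m k = (if k = Suc n then t else real m)" for m k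
  define A where "A m = {\<omega> \<in> space M. \<forall>k\<le>Suc n. \<eta> k \<omega> = j k \<and> (k \<ge> 1 \<longrightarrow> \<kappa> k \<omega> \<le> T m k)}" for m
  have [measurable]: "A m \<in> sets M" for m unfolding A_def by measurable
  have "incseq A"
    unfolding incseq_def A_def T_def by (auto intro: order.trans)
  then have "(\<lambda>m. prob (A m)) \<longlonglongrightarrow> prob (\<Union>m. A m)"
    by (intro finite_Lim_measure_incseq) auto
  also have "(\<Union>m. A m) = {\<omega> \<in> space M. (\<forall>k\<le>Suc n. \<eta> k \<omega> = j k) \<and> \<kappa> (Suc n) \<omega> \<le> t}" (is "_ = ?B")
  proof (intro set_eqI iffI)
    fix \<omega> assume \<omega>: "\<omega> \<in> ?B"
    \<comment> \<open>Finitely many sojourn times have a common bound, so each point of the limit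
      event lies in some \<open>A m\<close>.\<close>
    obtain m :: nat where m: "Max ((\<lambda>k. \<kappa> k \<omega>) ` {..Suc n}) \<le> real m"
      using real_arch_simple by blast
    have "\<kappa> k \<omega> \<le> real m" if "k \<le> Suc n" for k
      using m that by (subst (asm) Max_le_iff) auto
    then have "\<omega> \<in> A m" using \<omega> by (auto simp: A_def T_def)
    then show "\<omega> \<in> (\<Union>m. A m)" by blast
  qed (auto simp: A_def T_def)
  finally show "(\<lambda>m. prob (A m)) \<longlonglongrightarrow> prob ?B" .
  have "prob (A m) = (\<Prod>k\<in>{1..n}. Q (j (k - 1)) (j k) (real m)) * Q (j n) (j (Suc n)) t" for m
  proof -
    have "prob (A m) = (\<Prod>k\<in>{1..Suc n}. Q (j (k - 1)) (j k) (T m k))"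
      unfolding A_def by (rule path_prob) (use assms in auto)
    then show ?thesis by (simp add: T_def)
  qed
  then show "(\<lambda>m. prob (A m)) \<longlonglongrightarrow> (\<Prod>k\<in>{1..n}. p (j (k - 1)) (j k)) * Q (j n) (j (Suc n)) t"
    using assms by (auto intro!: tendsto_intros Q_seq)
qed

lemma path_prob_states:
  assumes "j 0 = i" "\<And>k. k \<le> n \<Longrightarrow> j k \<in> {1..N}"
  shows "prob {\<omega> \<in> space M. \<forall>k\<le>n. \<eta> k \<omega> = j k} = (\<Prod>k\<in>{1..n}. p (j (k - 1)) (j k))"
proof (cases n)
  case 0
  show ?thesis using path_prob[of j n] assms by (simp add: 0)
next
  case (Suc n')
  define A where "A m = {\<omega> \<in> space M. (\<forall>k\<le>Suc n'. \<eta> k \<omega> = j k) \<and> \<kappa> (Suc n') \<omega> \<le> real m}" for m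
  have [measurable]: "A m \<in> sets M" for m unfolding A_def by measurable
  have "incseq A"
    unfolding incseq_def A_def by (auto intro: order.trans)
  then have "(\<lambda>m. prob (A m)) \<longlonglongrightarrow> prob (\<Union>m. A m)"
    by (intro finite_Lim_measure_incseq) auto
  also have "(\<Union>m. A m) = {\<omega> \<in> space M. \<forall>k\<le>n. \<eta> k \<omega> = j k}"
    unfolding A_def Suc using real_arch_simple by auto
  finally have 1: "(\<lambda>m. prob (A m)) \<longlonglongrightarrow> prob {\<omega> \<in> space M. \<forall>k\<le>n. \<eta> k \<omega> = j k}" .
  have "prob (A m) = (\<Prod>k\<in>{1..n'}. p (j (k - 1)) (j k)) * Q (j n') (j (Suc n')) (real m)" for m
    unfolding A_def by (rule path_prob_last) (use assms Suc in auto)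
  then have "(\<lambda>m. prob (A m)) \<longlonglongrightarrow> (\<Prod>k\<in>{1..n'}. p (j (k - 1)) (j k)) * p (j n') (j (Suc n'))"
    using assms Suc by (auto intro!: tendsto_intros Q_seq)
  with 1 show ?thesis using LIMSEQ_unique by (fastforce simp: Suc)
qed

text \<open>The product formula for the path extended by \<open>b\<close> has just one more factor;
  this is the Markov property for a single past.\<close>

lemma path_prob_step:
  assumes "j 0 = i" "\<And>k. k \<le> n \<Longrightarrow> j k \<in> {1..N}" "b \<in> {1..N}"
  shows "prob {\<omega> \<in> space M. (\<forall>k\<le>n. \<eta> k \<omega> = j k) \<and> \<eta> (Suc n) \<omega> = b \<and> \<kappa> (Suc n) \<omega> \<le> t}
     = prob {\<omega> \<in> space M. \<forall>k\<le>n. \<eta> k \<omega> = j k} * Q (j n) b t"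
proof -
  define j' where "j' = j(Suc n := b)"
  have "prob {\<omega> \<in> space M. (\<forall>k\<le>Suc n. \<eta> k \<omega> = j' k) \<and> \<kappa> (Suc n) \<omega> \<le> t}
     = (\<Prod>k\<in>{1..n}. p (j' (k - 1)) (j' k)) * Q (j' n) (j' (Suc n)) t"
    by (rule path_prob_last) (use assms in \<open>auto simp: j'_def le_Suc_eq\<close>)
  also have "(\<Prod>k\<in>{1..n}. p (j' (k - 1)) (j' k)) = (\<Prod>k\<in>{1..n}. p (j (k - 1)) (j k))"
    by (intro prod.cong) (auto simp: j'_def)
  also have "\<dots> = prob {\<omega> \<in> space M. \<forall>k\<le>n. \<eta> k \<omega> = j k}"
    by (rule path_prob_states[symmetric]) (use assms in auto)
  also have "{\<omega> \<in> space M. (\<forall>k\<le>Suc n. \<eta> k \<omega> = j' k) \<and> \<kappa> (Suc n) \<omega> \<le> t}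
     = {\<omega> \<in> space M. (\<forall>k\<le>n. \<eta> k \<omega> = j k) \<and> \<eta> (Suc n) \<omega> = b \<and> \<kappa> (Suc n) \<omega> \<le> t}"
    by (auto simp: j'_def le_Suc_eq)
  finally show ?thesis by (simp add: j'_def)
qed

text \<open>Its probability is the taboo probability of Markov chain theory with taboo state
  \<open>i\<close>. For \<open>n = 0\<close> nothing has to be avoided, so the start at
  \<open>i\<close> itself is included. Requiring \<open>\<eta> 0 \<omega> = i\<close> restricts to
  the paths that \<open>path_prob\<close> covers.\<close>

definition taboo :: "nat \<Rightarrow> nat \<Rightarrow> 'a set" where
  "taboo n a = {\<omega> \<in> space M. \<eta> 0 \<omega> = i \<and> \<eta> n \<omega> = a \<and> (\<forall>m\<in>{1..n}. \<eta> m \<omega> \<noteq> i)}"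

lemma taboo_sets [measurable]: "taboo n a \<in> sets M"
  unfolding taboo_def by measurable

text \<open>The taboo event depends only on the states up to time \<open>n\<close>, so it is a
  finite disjoint union of cylinders that all end in \<open>a\<close>; the Markov property of each
  single past adds up.\<close>

lemma taboo_step:
  assumes a: "a \<in> {1..N}" and b: "b \<in> {1..N}"
  shows "prob {\<omega> \<in> taboo n a. \<eta> (Suc n) \<omega> = b \<and> \<kappa> (Suc n) \<omega> \<le> t} = prob (taboo n a) * Q a b t"
proof -
  \<comment> \<open>Paths are taken as extensional functions on \<open>{..n}\<close>: they are
    finite in number, and different ones differ at a time up to \<open>n\<close>, which makes their
    cylinders disjoint.\<close>
  define J where "J = {j \<in> {..n} \<rightarrow>\<^sub>E {1..N}. j 0 = i \<and> j n = a \<and> (\<forall>m\<in>{1..n}. j m \<noteq> i)}"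
  have fin: "finite J"
    unfolding J_def by (rule finite_subset[OF _ finite_PiE[of "{..n}" "\<lambda>_. {1..N}"]]) auto
  define C where "C j = {\<omega> \<in> space M. \<forall>k\<le>n. \<eta> k \<omega> = j k}" for j
  define E where "E = {\<omega> \<in> space M. \<eta> (Suc n) \<omega> = b \<and> \<kappa> (Suc n) \<omega> \<le> t}"
  have [measurable]: "C j \<in> sets M" for j unfolding C_def by measurable
  have [measurable]: "E \<in> sets M" unfolding E_def by measurable
  have U: "taboo n a = (\<Union>j\<in>J. C j)"
  proof (intro set_eqI iffI)
    fix \<omega> assume \<omega>: "\<omega> \<in> taboo n a"
    then have "restrict (\<lambda>k. \<eta> k \<omega>) {..n} \<in> J" "\<omega> \<in> C (restrict (\<lambda>k. \<eta> k \<omega>) {..n})"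
      using \<eta>_in by (auto simp: J_def C_def taboo_def)
    then show "\<omega> \<in> (\<Union>j\<in>J. C j)" by blast
  qed (auto simp: J_def C_def taboo_def)
  have disj: "disjoint_family_on C J"
    unfolding disjoint_family_on_def
  proof (intro ballI impI)
    fix j j' assume j: "j \<in> J" "j' \<in> J" "j \<noteq> j'"
    then have "j \<in> extensional {..n}" "j' \<in> extensional {..n}" by (auto simp: J_def PiE_def)
    then have "\<exists>k\<le>n. j k \<noteq> j' k" using j(3) by (auto intro: extensionalityI)
    then show "C j \<inter> C j' = {}" by (auto simp: C_def)
  qed
  have "{\<omega> \<in> taboo n a. \<eta> (Suc n) \<omega> = b \<and> \<kappa> (Suc n) \<omega> \<le> t} = (\<Union>j\<in>J. C j \<inter> E)"
    unfolding U by (auto simp: E_def C_def)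
  also have "prob \<dots> = (\<Sum>j\<in>J. prob (C j \<inter> E))"
    using disj by (intro finite_measure_finite_Union fin) (auto simp: disjoint_family_on_def)
  also have "\<dots> = (\<Sum>j\<in>J. prob (C j) * Q a b t)"
  proof (intro sum.cong refl)
    fix j assume j: "j \<in> J"
    have "prob {\<omega> \<in> space M. (\<forall>k\<le>n. \<eta> k \<omega> = j k) \<and> \<eta> (Suc n) \<omega> = b \<and> \<kappa> (Suc n) \<omega> \<le> t}
     = prob {\<omega> \<in> space M. \<forall>k\<le>n. \<eta> k \<omega> = j k} * Q (j n) b t"
      by (rule path_prob_step) (use j b in \<open>auto simp: J_def\<close>)
    also have "{\<omega> \<in> space M. (\<forall>k\<le>n. \<eta> k \<omega> = j k) \<and> \<eta> (Suc n) \<omega> = b \<and> \<kappa> (Suc n) \<omega> \<le> t} = C j \<inter> E"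
      by (auto simp: C_def E_def)
    finally show "prob (C j \<inter> E) = prob (C j) * Q a b t"
      using j by (simp add: C_def J_def)
  qed
  also have "\<dots> = prob (taboo n a) * Q a b t"
    unfolding U by (subst finite_measure_finite_Union[OF fin _ disj]) (auto simp: sum_distrib_right)
  finally show ?thesis .
qed

lemma taboo_step_state:
  assumes a: "a \<in> {1..N}" and b: "b \<in> {1..N}"
  shows "prob {\<omega> \<in> taboo n a. \<eta> (Suc n) \<omega> = b} = prob (taboo n a) * p a b"
proof (rule LIMSEQ_unique)
  define A where "A m = {\<omega> \<in> taboo n a. \<eta> (Suc n) \<omega> = b \<and> \<kappa> (Suc n) \<omega> \<le> real m}" for m
  have [measurable]: "A m \<in> sets M" for m
    unfolding A_def taboo_def by (auto simp: conj_assoc)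
  have "incseq A"
    unfolding incseq_def A_def by (auto intro: order.trans)
  then have "(\<lambda>m. prob (A m)) \<longlonglongrightarrow> prob (\<Union>m. A m)"
    by (intro finite_Lim_measure_incseq) auto
  also have "(\<Union>m. A m) = {\<omega> \<in> taboo n a. \<eta> (Suc n) \<omega> = b}"
    unfolding A_def using real_arch_simple by auto
  finally show "(\<lambda>m. prob (A m)) \<longlonglongrightarrow> prob {\<omega> \<in> taboo n a. \<eta> (Suc n) \<omega> = b}" .
  show "(\<lambda>m. prob (A m)) \<longlonglongrightarrow> prob (taboo n a) * p a b"
    unfolding A_def taboo_step[OF a b] by (intro tendsto_intros Q_seq a b)
qed

text \<open>A monotone function stays below its limit, here \<open>p k j = 0\<close>. Since
  condition E' speaks only of transitions in \<open>Y\<close>, the means of all others have to be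
  shown to vanish.\<close>

lemma kernel_zero: "Q k j t = 0" if "k \<in> {1..N}" "j \<in> {1..N}" "j \<notin> Y k"
proof (rule antisym)
  show "Q k j t \<le> 0"
    using Q_p[OF that(1,2)] unfolding p_zero[OF that]
    by (rule tendsto_lowerbound)
      (auto intro: eventually_mono[OF eventually_ge_at_top[of t]] monoD[OF Q_mono[OF that(1,2)]])
qed (rule Q_nonneg[OF that(1,2)])

lemma kernel_mean_zero: "kernel_mean (Q k j) = 0" if "k \<in> {1..N}" "j \<in> {1..N}" "j \<notin> Y k"
proof -
  have "Q k j = (\<lambda>_. 0)" using kernel_zero[OF that] by blast
  moreover have "emeasure (interval_measure (\<lambda>_. 0)) UNIV = ennreal 0"
    by (rule interval_measure_UNIV) (auto intro: tendsto_intros)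
  ultimately have "AE t in interval_measure (Q k j). t = 0"
    by (intro AE_I[of _ _ UNIV]) auto
  then have "(\<integral>t. t \<partial>interval_measure (Q k j)) = (\<integral>t. 0 \<partial>interval_measure (Q k j))"
    by (intro integral_cong_AE) auto
  then show ?thesis by (simp add: kernel_mean_def)
qed

text \<open>Irreducibility supplies a path from \<open>i\<close> to \<open>a\<close> of probability
  \<open>q > 0\<close>. Splitting this event by the next state gives
  \<open>q = q * (\<Sum>b\<in>{1..N}. p a b)\<close>, and \<open>q\<close> cancels.\<close>

lemma row_sum: "(\<Sum>b\<in>{1..N}. p a b) = 1" if a: "a \<in> {1..N}"
proof -
  obtain n :: nat and l where l: "l 0 = i" "l n = a" "\<And>m. m \<in> {1..n} \<Longrightarrow> l m \<in> Y (l (m - 1))"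
    using irreducible[OF i_in a] by metis
  have lN: "l k \<in> {1..N}" if "k \<le> n" for k
    using that by (induction k) (use l i_in Y_sub in fastforce)+
  define C where "C = {\<omega> \<in> space M. \<forall>k\<le>n. \<eta> k \<omega> = l k}"
  have [measurable]: "C \<in> sets M" unfolding C_def by measurable
  define q where "q = (\<Prod>k\<in>{1..n}. p (l (k - 1)) (l k))"
  have "0 < q"
    unfolding q_def by (intro prod_pos ballI p_pos lN l) auto
  have "q = prob C"
    unfolding C_def q_def by (rule path_prob_states[symmetric]) (use l lN in auto)
  also have "C = (\<Union>b\<in>{1..N}. {\<omega> \<in> C. \<eta> (Suc n) \<omega> = b})"
    using \<eta>_in by (auto simp: C_def)
  also have "prob \<dots> = (\<Sum>b\<in>{1..N}. prob {\<omega> \<in> C. \<eta> (Suc n) \<omega> = b})"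
    by (rule finite_measure_finite_Union) (auto simp: disjoint_family_on_def)
  also have "\<dots> = (\<Sum>b\<in>{1..N}. q * p a b)"
  proof (intro sum.cong refl)
    fix b assume b: "b \<in> {1..N}"
    define j where "j = l(Suc n := b)"
    have "prob {\<omega> \<in> space M. \<forall>k\<le>Suc n. \<eta> k \<omega> = j k} = (\<Prod>k\<in>{1..Suc n}. p (j (k - 1)) (j k))"
      by (rule path_prob_states) (use l lN b in \<open>auto simp: j_def le_Suc_eq\<close>)
    also have "\<dots> = (\<Prod>k\<in>{1..n}. p (j (k - 1)) (j k)) * p a b"
      using l by (simp add: j_def)
    also have "(\<Prod>k\<in>{1..n}. p (j (k - 1)) (j k)) = q"
      unfolding q_def by (intro prod.cong) (auto simp: j_def)
    also have "{\<omega> \<in> space M. \<forall>k\<le>Suc n. \<eta> k \<omega> = j k} = {\<omega> \<in> C. \<eta> (Suc n) \<omega> = b}"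
      by (auto simp: C_def j_def le_Suc_eq)
    finally show "prob {\<omega> \<in> C. \<eta> (Suc n) \<omega> = b} = q * p a b" .
  qed
  also have "\<dots> = q * (\<Sum>b\<in>{1..N}. p a b)" by (simp add: sum_distrib_left)
  finally show ?thesis using \<open>0 < q\<close> by simp
qed

section \<open>Taboo probabilities and expected numbers of visits\<close>

definition u where "u n a = prob (taboo n a)"

lemma u_nonneg: "0 \<le> u n a" by (simp add: u_def)

lemma start_state: "AE \<omega> in M. \<eta> 0 \<omega> = i" "prob {\<omega> \<in> space M. \<eta> 0 \<omega> = i} = 1"
proof -
  show *: "prob {\<omega> \<in> space M. \<eta> 0 \<omega> = i} = 1"
    using path_prob_states[of "\<lambda>_. i" 0] i_in by simp
  then show "AE \<omega> in M. \<eta> 0 \<omega> = i" by (subst (asm) prob_Collect_eq_1) auto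
qed

lemma u_0: "u 0 a = (if a = i then 1 else 0)"
proof (cases "a = i")
  case True
  then show ?thesis using start_state(2) by (simp add: u_def taboo_def)
next
  case False
  then have "taboo 0 a = {}" by (auto simp: taboo_def)
  then show ?thesis using False by (simp add: u_def)
qed

lemma u_i: "u (Suc n) i = 0"
proof -
  have "taboo (Suc n) i = {}" by (auto simp: taboo_def)
  then show ?thesis by (simp add: u_def)
qed

lemma u_Suc:
  assumes "b \<in> {1..N}" "b \<noteq> i"
  shows "u (Suc n) b = (\<Sum>a\<in>{1..N}. u n a * p a b)"
proof -
  have "taboo (Suc n) b = (\<Union>a\<in>{1..N}. {\<omega> \<in> taboo n a. \<eta> (Suc n) \<omega> = b})"
    using assms(2) \<eta>_in by (auto simp: taboo_def le_Suc_eq)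
  also have "prob \<dots> = (\<Sum>a\<in>{1..N}. prob {\<omega> \<in> taboo n a. \<eta> (Suc n) \<omega> = b})"
    by (rule finite_measure_finite_Union) (auto simp: disjoint_family_on_def taboo_def)
  also have "\<dots> = (\<Sum>a\<in>{1..N}. u n a * p a b)"
    unfolding u_def by (intro sum.cong refl taboo_step_state assms(1))
  finally show ?thesis by (simp only: u_def)
qed

text \<open>The term of index \<open>n\<close> is the probability that the first return occurs at
  time \<open>n + 1\<close>, and these events exclude each other.\<close>

lemma u_return: "(\<Sum>n<m. \<Sum>a\<in>{1..N}. u n a * p a i) \<le> 1"
proof -
  define F where "F n = (\<Union>a\<in>{1..N}. {\<omega> \<in> taboo n a. \<eta> (Suc n) \<omega> = i})" for n
  have [measurable]: "F n \<in> sets M" for n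
    unfolding F_def by auto
  have "prob (F n) = (\<Sum>a\<in>{1..N}. u n a * p a i)" for n
  proof -
    have "prob (F n) = (\<Sum>a\<in>{1..N}. prob {\<omega> \<in> taboo n a. \<eta> (Suc n) \<omega> = i})"
      unfolding F_def
      by (rule finite_measure_finite_Union) (auto simp: disjoint_family_on_def taboo_def)
    also have "\<dots> = (\<Sum>a\<in>{1..N}. u n a * p a i)"
      unfolding u_def by (intro sum.cong refl taboo_step_state i_in)
    finally show ?thesis .
  qed
  then have "(\<Sum>n<m. \<Sum>a\<in>{1..N}. u n a * p a i) = (\<Sum>n<m. prob (F n))" by simp
  also have "\<dots> = prob (\<Union>n<m. F n)"
  proof (rule finite_measure_finite_Union[symmetric])
    show "disjoint_family_on F {..<m}"
      unfolding disjoint_family_on_def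
    proof (intro ballI impI)
      have less: "F n \<inter> F n' = {}" if "n < n'" for n n'
      proof -
        have "Suc n \<in> {1..n'}" using that by auto
        then show ?thesis by (auto simp: F_def taboo_def)
      qed
      fix n n' :: nat assume "n \<noteq> n'"
      then show "F n \<inter> F n' = {}"
        using less[of n n'] less[of n' n] by (cases "n < n'") auto
    qed
  qed auto
  also have "\<dots> \<le> 1" by simp
  finally show ?thesis .
qed

text \<open>Induction along a path from \<open>a\<close> to \<open>i\<close>. If the next state
  \<open>b\<close> is \<open>i\<close>, then \<open>u n a * p a b\<close> is at most the probability
  of a first return at time \<open>n + 1\<close>, and these sum to at most one. Otherwise
  \<open>u n a * p a b <= u (Suc n) b\<close>, and the sums for \<open>b\<close> are bounded by
  induction. Since \<open>p a b > 0\<close>, it can be divided out.\<close>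

lemma u_summable: "summable (\<lambda>n. u n a)" if a: "a \<in> {1..N}"
proof -
  have bound: "\<exists>C. \<forall>m. (\<Sum>n<m. u n a) \<le> C"
    if "a \<in> {1..N}" "l 0 = a" "l n = i" "1 \<le> n" "\<And>m. m \<in> {1..n} \<Longrightarrow> l m \<in> Y (l (m - 1))"
      for n :: nat and l a
    using that
  proof (induction n arbitrary: l a)
    case (Suc n)
    define b where "b = l 1"
    have bY: "b \<in> Y a" using Suc.prems(5)[of 1] Suc.prems(2) by (simp add: b_def)
    then have b: "b \<in> {1..N}" "0 < p a b"
      using Y_sub[OF Suc.prems(1)] p_pos[OF Suc.prems(1)] bY by blast+
    have one: "u n a * p a b \<le> (\<Sum>c\<in>{1..N}. u n c * p c b)" for n
      using Suc.prems(1) b by (intro member_le_sum) (auto intro!: mult_nonneg_nonneg u_nonneg p_nonneg)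
    have "\<exists>C. \<forall>m. (\<Sum>n<m. u n a) * p a b \<le> C"
    proof (cases "b = i")
      case True
      have "(\<Sum>n<m. u n a) * p a b \<le> 1" for m
        unfolding sum_distrib_right
        by (rule order.trans[OF sum_mono u_return[of m]]) (use one True in simp)
      then show ?thesis by blast
    next
      case False
      then have "n \<noteq> 0" using Suc.prems(3) by (intro notI) (simp add: b_def)
      have "\<exists>C. \<forall>m. (\<Sum>n<m. u n b) \<le> C"
      proof (rule Suc.IH)
        show "l (Suc m) \<in> Y (l (Suc (m - 1)))" if "m \<in> {1..n}" for m
          using Suc.prems(5)[of "Suc m"] that by simp
      qed (use \<open>n \<noteq> 0\<close> Suc.prems b in \<open>auto simp: b_def\<close>)
      then obtain C where C: "\<And>m. (\<Sum>n<m. u n b) \<le> C" by blast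
      have "(\<Sum>n<m. u n a) * p a b \<le> C" for m
      proof -
        have "(\<Sum>n<m. u n a) * p a b \<le> (\<Sum>n<m. u (Suc n) b)"
          unfolding sum_distrib_right u_Suc[OF b(1) False] by (intro sum_mono one)
        also have "\<dots> \<le> (\<Sum>n<Suc m. u n b)"
          unfolding sum.lessThan_Suc_shift using u_nonneg by simp
        finally show ?thesis using C[of "Suc m"] by simp
      qed
      then show ?thesis by blast
    qed
    then obtain C where "\<And>m. (\<Sum>n<m. u n a) * p a b \<le> C" by blast
    then have "\<And>m. (\<Sum>n<m. u n a) \<le> C / p a b" using b(2) by (simp add: field_simps)
    then show ?case by blast
  qed simp
  obtain n :: nat and l where "1 \<le> n" "l 0 = a" "l n = i" "\<And>m. m \<in> {1..n} \<Longrightarrow> l m \<in> Y (l (m - 1))"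
    using irreducible[OF a i_in] by metis
  then obtain C where "\<And>m. (\<Sum>n<m. u n a) \<le> C" using bound[OF a] by blast
  then show ?thesis by (intro summableI_nonneg_bounded u_nonneg)
qed

definition v where "v a = (\<Sum>n. u n a)"

text \<open>The start at time 0 is counted, the return is not.\<close>

lemma v_i: "v i = 1"
proof -
  have "v i = u 0 i + (\<Sum>n. u (Suc n) i)"
    unfolding v_def using suminf_split_head[OF u_summable[OF i_in]] by simp
  then show ?thesis by (simp add: u_i u_0)
qed

lemma v_eq: "v b = (\<Sum>a\<in>{1..N}. v a * p a b)" if b: "b \<in> {1..N}" "b \<noteq> i"
proof -
  have "v b = u 0 b + (\<Sum>n. u (Suc n) b)"
    unfolding v_def using suminf_split_head[OF u_summable[OF b(1)]] by simp
  also have "\<dots> = (\<Sum>n. \<Sum>a\<in>{1..N}. u n a * p a b)"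
    using b by (simp add: u_0 u_Suc)
  also have "\<dots> = (\<Sum>a\<in>{1..N}. \<Sum>n. u n a * p a b)"
    by (intro suminf_sum summable_mult2 u_summable)
  also have "\<dots> = (\<Sum>a\<in>{1..N}. v a * p a b)"
    unfolding v_def by (intro sum.cong refl suminf_mult2[symmetric] u_summable)
  finally show ?thesis .
qed

text \<open>Having avoided \<open>i\<close> up to time \<open>n\<close> has probability at most the
  sum of the \<open>u n a\<close>, which tends to zero as each series converges. The
  \<open>LEAST\<close> in \<open>return_time\<close> is meaningful only where a return
  occurs.\<close>

lemma return_AE: "AE \<omega> in M. \<exists>n\<ge>1. \<eta> n \<omega> = i"
proof -
  define B where "B = {\<omega> \<in> space M. \<eta> 0 \<omega> = i \<and> (\<forall>n\<ge>1. \<eta> n \<omega> \<noteq> i)}"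
  have [measurable]: "B \<in> sets M" unfolding B_def by measurable
  have "prob B \<le> (\<Sum>a\<in>{1..N}. u n a)" for n
  proof -
    have "B \<subseteq> (\<Union>a\<in>{1..N}. taboo n a)" using \<eta>_in by (auto simp: B_def taboo_def)
    then have "prob B \<le> prob (\<Union>a\<in>{1..N}. taboo n a)" by (intro finite_measure_mono) auto
    also have "\<dots> \<le> (\<Sum>a\<in>{1..N}. u n a)"
      unfolding u_def by (intro finite_measure_subadditive_finite) auto
    finally show ?thesis .
  qed
  moreover have "(\<lambda>n. \<Sum>a\<in>{1..N}. u n a) \<longlonglongrightarrow> (\<Sum>a\<in>{1..N}. 0)"
    by (intro tendsto_sum summable_LIMSEQ_zero u_summable)
  ultimately have "prob B \<le> 0" by (intro LIMSEQ_le_const) auto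
  then have "AE \<omega> in M. \<omega> \<notin> B"
    by (intro AE_not_in) (auto simp: null_sets_def emeasure_eq_measure measure_le_0_iff)
  with start_state(1) AE_space show ?thesis by eventually_elim (auto simp: B_def)
qed


section \<open>Sojourn times and kernel means\<close>

lemma kernel_AE_nonneg: "AE t in interval_measure (Q a b). 0 \<le> t"
  if "a \<in> {1..N}" "b \<in> {1..N}"
proof (rule AE_I[of _ _ "{..0}"])
  have "(Q a b \<longlongrightarrow> 0) at_bot"
    by (rule tendsto_eventually)
      (auto intro: eventually_mono[OF eventually_le_at_bot[of 0]] Q_zero[OF that])
  then have "emeasure (interval_measure (Q a b)) {..0} = Q a b 0"
    by (intro emeasure_interval_measure_Iic monoD[OF Q_mono[OF that]] Q_rcont[OF that])
  then show "emeasure (interval_measure (Q a b)) {..0} = 0"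
    using Q_zero[OF that, of 0] by simp
qed auto

lemma kernel_mean_nonneg: "0 \<le> kernel_mean (Q a b)" if "a \<in> {1..N}" "b \<in> {1..N}"
  unfolding kernel_mean_def by (rule integral_nonneg_AE[OF kernel_AE_nonneg[OF that]])

text \<open>By \<open>taboo_step\<close> both sides have the distribution function
  \<open>u n a * Q a b t\<close>, and it determines a finite measure on the reals. This makes the
  mean of the sojourn time on the event computable from the kernel.\<close>

lemma sojourn_distr:
  assumes a: "a \<in> {1..N}" and b: "b \<in> {1..N}"
  shows "distr (density M (indicator {\<omega> \<in> taboo n a. \<eta> (Suc n) \<omega> = b})) borel (\<kappa> (Suc n))
    = density (interval_measure (Q a b)) (\<lambda>_. ennreal (u n a))" (is "?D = ?K")
proof (rule cdf_unique')
  define A where "A = {\<omega> \<in> taboo n a. \<eta> (Suc n) \<omega> = b}"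
  have [measurable]: "A \<in> sets M" unfolding A_def by auto
  have bot: "(Q a b \<longlongrightarrow> 0) at_bot"
    by (rule tendsto_eventually)
      (auto intro: eventually_mono[OF eventually_le_at_bot[of 0]] Q_zero[OF a b])
  have D: "emeasure ?D X = emeasure M (A \<inter> (\<kappa> (Suc n) -` X \<inter> space M))" if "X \<in> sets borel" for X
    using that unfolding A_def[symmetric] by (subst emeasure_distr) (auto simp: emeasure_restricted)
  have K: "emeasure ?K X = ennreal (u n a) * emeasure (interval_measure (Q a b)) X" if "X \<in> sets borel" for X
    using that by (simp add: emeasure_density_const)
  have fin: "finite_borel_measure (interval_measure (Q a b))"
    by (rule finite_borel_measure_interval_measure[OF monoD[OF Q_mono[OF a b]] Q_rcont[OF a b] bot
        Q_p[OF a b] p_nonneg[OF a b]])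
  then interpret K: finite_borel_measure "interval_measure (Q a b)" .
  show "finite_borel_measure ?D"
    by (intro finite_borel_measure.intro finite_measureI finite_borel_measure_axioms.intro)
      (auto simp: D)
  show "finite_borel_measure ?K"
    using K.emeasure_finite[of UNIV]
    by (intro finite_borel_measure.intro finite_measureI finite_borel_measure_axioms.intro)
      (auto simp: K ennreal_mult_eq_top_iff)
  show "cdf ?D = cdf ?K"
  proof
    fix t
    have "emeasure ?D {..t} = ennreal (prob {\<omega> \<in> taboo n a. \<eta> (Suc n) \<omega> = b \<and> \<kappa> (Suc n) \<omega> \<le> t})"
      unfolding D[of "{..t}", simplified] emeasure_eq_measure
      by (intro arg_cong[of _ _ "\<lambda>X. ennreal (prob X)"]) (auto simp: A_def taboo_def)
    also have "\<dots> = ennreal (u n a) * ennreal (Q a b t)"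
      by (simp add: taboo_step[OF a b] u_def ennreal_mult Q_nonneg[OF a b])
    also have "ennreal (Q a b t) = emeasure (interval_measure (Q a b)) {..t}"
      by (rule emeasure_interval_measure_Iic[symmetric, OF monoD[OF Q_mono[OF a b]] Q_rcont[OF a b] bot])
    also have "ennreal (u n a) * \<dots> = emeasure ?K {..t}" by (simp add: K)
    finally show "cdf ?D t = cdf ?K t" by (simp add: cdf_def measure_def)
  qed
qed

lemma nn_integral_sojourn:
  assumes a: "a \<in> {1..N}" and b: "b \<in> {1..N}"
  shows "(\<integral>\<^sup>+\<omega>. ennreal (\<kappa> (Suc n) \<omega>) * indicator {\<omega> \<in> taboo n a. \<eta> (Suc n) \<omega> = b} \<omega> \<partial>M)
    = ennreal (u n a * kernel_mean (Q a b))"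
proof -
  define A where "A = {\<omega> \<in> taboo n a. \<eta> (Suc n) \<omega> = b}"
  have [measurable]: "A \<in> sets M" unfolding A_def by auto
  have "(\<integral>\<^sup>+\<omega>. ennreal (\<kappa> (Suc n) \<omega>) * indicator A \<omega> \<partial>M)
     = (\<integral>\<^sup>+\<omega>. ennreal (\<kappa> (Suc n) \<omega>) \<partial>density M (indicator A))"
    by (subst nn_integral_density) (auto simp: mult.commute)
  also have "\<dots> = (\<integral>\<^sup>+t. ennreal t \<partial>distr (density M (indicator A)) borel (\<kappa> (Suc n)))"
    by (subst nn_integral_distr) auto
  also have "\<dots> = (\<integral>\<^sup>+t. ennreal (u n a) * ennreal t \<partial>interval_measure (Q a b))"
    unfolding A_def sojourn_distr[OF a b] by (subst nn_integral_density) auto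
  also have "\<dots> = ennreal (u n a) * (\<integral>\<^sup>+t. ennreal t \<partial>interval_measure (Q a b))"
    by (rule nn_integral_cmult) auto
  also have "(\<integral>\<^sup>+t. ennreal t \<partial>interval_measure (Q a b)) = ennreal (kernel_mean (Q a b))"
    unfolding kernel_mean_def by (rule nn_integral_eq_integral[OF e_fin[OF a b] kernel_AE_nonneg[OF a b]])
  finally show ?thesis by (simp add: A_def ennreal_mult u_nonneg kernel_mean_nonneg[OF a b])
qed

section \<open>The return time as a sum over visits\<close>

lemma return_time_measurable [measurable]: "return_time \<eta> \<kappa> i \<in> borel_measurable M"
proof -
  have "(\<lambda>\<omega>. \<Sum>k\<in>{1..(LEAST n. n \<ge> 1 \<and> \<eta> n \<omega> = i)}. \<kappa> k \<omega>) \<in> borel_measurable M"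
    by (rule measurable_compose_countable[where f = "\<lambda>n \<omega>. \<Sum>k\<in>{1..n}. \<kappa> k \<omega>"]) measurable
  then show ?thesis by (simp add: return_time_def[abs_def])
qed

text \<open>The return time adds \<open>\<kappa> (Suc n)\<close> over \<open>n < \<nu>\<close>, that
  is, over those \<open>n\<close> up to which no return has occurred. For such \<open>n\<close> only
  the pair of the states at times \<open>n\<close> and \<open>n + 1\<close> contributes to the
  double sum; for other \<open>n\<close> no pair does.\<close>

lemma return_time_series:
  assumes "\<omega> \<in> space M" "\<eta> 0 \<omega> = i" "\<exists>n\<ge>1. \<eta> n \<omega> = i"
  shows "ennreal (return_time \<eta> \<kappa> i \<omega>) = (\<Sum>n. \<Sum>a\<in>{1..N}. \<Sum>b\<in>{1..N}.
     ennreal (\<kappa> (Suc n) \<omega>) * indicator {\<omega> \<in> taboo n a. \<eta> (Suc n) \<omega> = b} \<omega>)"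
proof -
  define \<nu> where "\<nu> = (LEAST n. n \<ge> 1 \<and> \<eta> n \<omega> = i)"
  have \<nu>: "1 \<le> \<nu>" "\<eta> \<nu> \<omega> = i"
    using LeastI_ex[of "\<lambda>n. n \<ge> 1 \<and> \<eta> n \<omega> = i"] assms(3) unfolding \<nu>_def by auto
  have *: "(\<forall>m\<in>{1..n}. \<eta> m \<omega> \<noteq> i) \<longleftrightarrow> n < \<nu>" for n
  proof
    assume "\<forall>m\<in>{1..n}. \<eta> m \<omega> \<noteq> i"
    then have "\<nu> \<notin> {1..n}" using \<nu>(2) by blast
    then show "n < \<nu>" using \<nu>(1) by simp
  next
    assume n: "n < \<nu>"
    show "\<forall>m\<in>{1..n}. \<eta> m \<omega> \<noteq> i"
    proof
      fix m assume m: "m \<in> {1..n}"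
      then have "\<not> (m \<ge> 1 \<and> \<eta> m \<omega> = i)"
        using n not_less_Least[of m "\<lambda>n. n \<ge> 1 \<and> \<eta> n \<omega> = i"] unfolding \<nu>_def by simp
      with m show "\<eta> m \<omega> \<noteq> i" by simp
    qed
  qed
  have taboo_iff: "\<omega> \<in> taboo n a \<longleftrightarrow> a = \<eta> n \<omega> \<and> n < \<nu>" for n a
    unfolding *[symmetric] taboo_def using assms(1,2) by blast
  have "(\<Sum>a\<in>{1..N}. \<Sum>b\<in>{1..N}.
     ennreal (\<kappa> (Suc n) \<omega>) * indicator {\<omega> \<in> taboo n a. \<eta> (Suc n) \<omega> = b} \<omega>)
     = (if n < \<nu> then ennreal (\<kappa> (Suc n) \<omega>) else 0)" (is "?L n = _") for n
  proof -
    have "?L n = (\<Sum>a\<in>{1..N}. \<Sum>b\<in>{1..N}. if a = \<eta> n \<omega> then if b = \<eta> (Suc n) \<omega> then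
        (if n < \<nu> then ennreal (\<kappa> (Suc n) \<omega>) else 0) else 0 else 0)"
      by (intro sum.cong refl) (simp add: taboo_iff indicator_def)
    also have "\<dots> = (\<Sum>a\<in>{1..N}. if a = \<eta> n \<omega> then \<Sum>b\<in>{1..N}. if b = \<eta> (Suc n) \<omega> then
        (if n < \<nu> then ennreal (\<kappa> (Suc n) \<omega>) else 0) else 0 else 0)"
      by (intro sum.cong refl) auto
    also have "\<dots> = (if n < \<nu> then ennreal (\<kappa> (Suc n) \<omega>) else 0)"
      using \<eta>_in[OF assms(1)] by (subst sum.delta, simp, subst sum.delta, simp) auto
    finally show ?thesis .
  qed
  then have "(\<Sum>n. ?L n) = (\<Sum>n. if n < \<nu> then ennreal (\<kappa> (Suc n) \<omega>) else 0)" by simp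
  also have "\<dots> = (\<Sum>n<\<nu>. ennreal (\<kappa> (Suc n) \<omega>))"
    by (subst suminf_finite[of "{..<\<nu>}"]) auto
  also have "\<dots> = ennreal (\<Sum>n<\<nu>. \<kappa> (Suc n) \<omega>)"
    using \<kappa>_pos[OF assms(1)] by (intro sum_ennreal) (auto intro: less_imp_le)
  also have "(\<Sum>n<\<nu>. \<kappa> (Suc n) \<omega>) = return_time \<eta> \<kappa> i \<omega>"
    unfolding return_time_def \<nu>_def[symmetric] Let_def by (simp add: sum.atLeast1_atMost_eq)
  finally show ?thesis ..
qed

text \<open>With nonnegative integrals, series and integral can be exchanged before integrability is
  known. Finiteness then follows from the summability of \<open>u\<close>.\<close>

lemma expected_return_time_eq:
  "expected_return_time M \<eta> \<kappa> i = (\<Sum>a\<in>{1..N}. v a * (\<Sum>b\<in>{1..N}. kernel_mean (Q a b)))"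
proof -
  have [measurable]: "{\<omega> \<in> taboo n a. \<eta> (Suc n) \<omega> = b} \<in> sets M" for n a b by auto
  have "(\<integral>\<^sup>+\<omega>. ennreal (return_time \<eta> \<kappa> i \<omega>) \<partial>M)
     = (\<integral>\<^sup>+\<omega>. (\<Sum>n. \<Sum>a\<in>{1..N}. \<Sum>b\<in>{1..N}.
        ennreal (\<kappa> (Suc n) \<omega>) * indicator {\<omega> \<in> taboo n a. \<eta> (Suc n) \<omega> = b} \<omega>) \<partial>M)"
  \<comment> \<open>The series is valid off the null set where the chain starts elsewhere or never
    returns.\<close>
  proof (rule nn_integral_cong_AE)
    show "AE \<omega> in M. ennreal (return_time \<eta> \<kappa> i \<omega>) = (\<Sum>n. \<Sum>a\<in>{1..N}. \<Sum>b\<in>{1..N}.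
        ennreal (\<kappa> (Suc n) \<omega>) * indicator {\<omega> \<in> taboo n a. \<eta> (Suc n) \<omega> = b} \<omega>)"
      using AE_space start_state(1) return_AE by eventually_elim (rule return_time_series)
  qed
  also have "\<dots> = (\<Sum>n. \<Sum>a\<in>{1..N}. \<Sum>b\<in>{1..N}. \<integral>\<^sup>+\<omega>.
        ennreal (\<kappa> (Suc n) \<omega>) * indicator {\<omega> \<in> taboo n a. \<eta> (Suc n) \<omega> = b} \<omega> \<partial>M)"
    by (subst nn_integral_suminf, measurable)
      (intro suminf_cong, subst nn_integral_sum, measurable,
       intro sum.cong refl, subst nn_integral_sum, measurable)
  also have "\<dots> = (\<Sum>n. ennreal (\<Sum>a\<in>{1..N}. u n a * (\<Sum>b\<in>{1..N}. kernel_mean (Q a b))))"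
  proof (intro suminf_cong)
    fix n
    have "(\<Sum>a\<in>{1..N}. \<Sum>b\<in>{1..N}. \<integral>\<^sup>+\<omega>.
        ennreal (\<kappa> (Suc n) \<omega>) * indicator {\<omega> \<in> taboo n a. \<eta> (Suc n) \<omega> = b} \<omega> \<partial>M)
       = (\<Sum>a\<in>{1..N}. \<Sum>b\<in>{1..N}. ennreal (u n a * kernel_mean (Q a b)))"
      by (intro sum.cong refl nn_integral_sojourn)
    also have "\<dots> = ennreal (\<Sum>a\<in>{1..N}. \<Sum>b\<in>{1..N}. u n a * kernel_mean (Q a b))"
      by (subst sum_ennreal[symmetric], force intro!: sum_nonneg mult_nonneg_nonneg u_nonneg kernel_mean_nonneg)
         (intro sum.cong refl sum_ennreal mult_nonneg_nonneg u_nonneg kernel_mean_nonneg)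
    finally show "(\<Sum>a\<in>{1..N}. \<Sum>b\<in>{1..N}. \<integral>\<^sup>+\<omega>.
        ennreal (\<kappa> (Suc n) \<omega>) * indicator {\<omega> \<in> taboo n a. \<eta> (Suc n) \<omega> = b} \<omega> \<partial>M)
       = ennreal (\<Sum>a\<in>{1..N}. u n a * (\<Sum>b\<in>{1..N}. kernel_mean (Q a b)))"
      by (simp add: sum_distrib_left)
  qed
  also have "\<dots> = ennreal (\<Sum>n. \<Sum>a\<in>{1..N}. u n a * (\<Sum>b\<in>{1..N}. kernel_mean (Q a b)))"
    by (intro suminf_ennreal2 sum_nonneg mult_nonneg_nonneg u_nonneg kernel_mean_nonneg
        summable_sum summable_mult2 u_summable)
  also have "(\<Sum>n. \<Sum>a\<in>{1..N}. u n a * (\<Sum>b\<in>{1..N}. kernel_mean (Q a b)))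
      = (\<Sum>a\<in>{1..N}. \<Sum>n. u n a * (\<Sum>b\<in>{1..N}. kernel_mean (Q a b)))"
    by (intro suminf_sum summable_mult2 u_summable)
  also have "\<dots> = (\<Sum>a\<in>{1..N}. v a * (\<Sum>b\<in>{1..N}. kernel_mean (Q a b)))"
    unfolding v_def by (intro sum.cong refl suminf_mult2[symmetric] u_summable)
  finally have "(\<integral>\<^sup>+\<omega>. ennreal (return_time \<eta> \<kappa> i \<omega>) \<partial>M)
     = ennreal (\<Sum>a\<in>{1..N}. v a * (\<Sum>b\<in>{1..N}. kernel_mean (Q a b)))" .
  moreover have "0 \<le> (\<Sum>a\<in>{1..N}. v a * (\<Sum>b\<in>{1..N}. kernel_mean (Q a b)))"
    unfolding v_def
    by (intro sum_nonneg mult_nonneg_nonneg suminf_nonneg u_summable u_nonneg kernel_mean_nonneg)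
  moreover have "AE \<omega> in M. 0 \<le> return_time \<eta> \<kappa> i \<omega>"
    using AE_space by eventually_elim
      (auto simp: return_time_def Let_def intro!: sum_nonneg less_imp_le[OF \<kappa>_pos])
  ultimately show ?thesis
    unfolding expected_return_time_def by (subst integral_eq_nn_integral) auto
qed

end

subsection \<open>Expansion of the expected return time\<close>

theorem theorem3:
  fixes N :: nat and \<epsilon>\<^sub>0 :: real and i :: nat
    and M :: "real \<Rightarrow> 'a measure"
    and \<eta> :: "real \<Rightarrow> nat \<Rightarrow> 'a \<Rightarrow> nat" and \<kappa> :: "real \<Rightarrow> nat \<Rightarrow> 'a \<Rightarrow> real"
    and Q :: "real \<Rightarrow> nat \<Rightarrow> nat \<Rightarrow> real \<Rightarrow> real"
    and p :: "real \<Rightarrow> nat \<Rightarrow> nat \<Rightarrow> real"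
    and Y :: "nat \<Rightarrow> nat set"
    and lm lp :: "nat \<Rightarrow> nat \<Rightarrow> int" and a :: "nat \<Rightarrow> nat \<Rightarrow> int \<Rightarrow> real"
    and \<delta> G \<epsilon>p :: "nat \<Rightarrow> nat \<Rightarrow> real"
    and mm mp :: "nat \<Rightarrow> nat \<Rightarrow> int" and b :: "nat \<Rightarrow> nat \<Rightarrow> int \<Rightarrow> real"
    and \<delta>d Gd \<epsilon>e :: "nat \<Rightarrow> nat \<Rightarrow> real"
  assumes eps0: "0 < \<epsilon>\<^sub>0" "\<epsilon>\<^sub>0 \<le> 1"
    and i_in: "i \<in> {1..N}"
    \<comment> \<open>standing regularity: Q_kj are distribution-type functions with Q_kj(0) = 0,
        p_kj = Q_kj(infinity), and e_kj finite\<close>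
    and Q_mono: "\<And>\<epsilon> k j. \<epsilon> \<in> {0<..\<epsilon>\<^sub>0} \<Longrightarrow> k \<in> {1..N} \<Longrightarrow> j \<in> {1..N} \<Longrightarrow> mono (Q \<epsilon> k j)"
    and Q_rcont: "\<And>\<epsilon> k j t. \<epsilon> \<in> {0<..\<epsilon>\<^sub>0} \<Longrightarrow> k \<in> {1..N} \<Longrightarrow> j \<in> {1..N} \<Longrightarrow>
        continuous (at_right t) (Q \<epsilon> k j)"
    and Q_zero: "\<And>\<epsilon> k j t. \<epsilon> \<in> {0<..\<epsilon>\<^sub>0} \<Longrightarrow> k \<in> {1..N} \<Longrightarrow> j \<in> {1..N} \<Longrightarrow> t \<le> 0 \<Longrightarrow>
        Q \<epsilon> k j t = 0"
    and Q_p: "\<And>\<epsilon> k j. \<epsilon> \<in> {0<..\<epsilon>\<^sub>0} \<Longrightarrow> k \<in> {1..N} \<Longrightarrow> j \<in> {1..N} \<Longrightarrow>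
        (Q \<epsilon> k j \<longlongrightarrow> p \<epsilon> k j) at_top"
    and e_fin: "\<And>\<epsilon> k j. \<epsilon> \<in> {0<..\<epsilon>\<^sub>0} \<Longrightarrow> k \<in> {1..N} \<Longrightarrow> j \<in> {1..N} \<Longrightarrow>
        integrable (interval_measure (Q \<epsilon> k j)) (\<lambda>t. t)"
    \<comment> \<open>for every epsilon, the semi-Markov process with kernel Q epsilon, started at i\<close>
    and proc: "\<And>\<epsilon>. \<epsilon> \<in> {0<..\<epsilon>\<^sub>0} \<Longrightarrow> semi_markov_chain (M \<epsilon>) (\<eta> \<epsilon>) (\<kappa> \<epsilon>) (Q \<epsilon>) N i"
    \<comment> \<open>Condition A\<close>
    and A_Y: "\<And>k. k \<in> {1..N} \<Longrightarrow> Y k \<noteq> {} \<and> Y k \<subseteq> {1..N}"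
    and A_a: "\<And>\<epsilon> k j. \<epsilon> \<in> {0<..\<epsilon>\<^sub>0} \<Longrightarrow> k \<in> {1..N} \<Longrightarrow> j \<in> Y k \<Longrightarrow> p \<epsilon> k j > 0"
    and A_b: "\<And>\<epsilon> k j. \<epsilon> \<in> {0<..\<epsilon>\<^sub>0} \<Longrightarrow> k \<in> {1..N} \<Longrightarrow> j \<in> {1..N} \<Longrightarrow> j \<notin> Y k \<Longrightarrow>
        p \<epsilon> k j = 0"
    and A_c: "\<And>k j. k \<in> {1..N} \<Longrightarrow> j \<in> {1..N} \<Longrightarrow>
        \<exists>n\<ge>1. \<exists>l::nat \<Rightarrow> nat. l 0 = k \<and> l n = j \<and> (\<forall>m\<in>{1..n}. l m \<in> Y (l (m - 1)))"
    \<comment> \<open>Condition D'\<close>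
    and D_l: "\<And>k j. k \<in> {1..N} \<Longrightarrow> j \<in> Y k \<Longrightarrow> 0 \<le> lm k j \<and> lm k j \<le> lp k j \<and> a k j (lm k j) > 0"
    and D_par: "\<And>k j. k \<in> {1..N} \<Longrightarrow> j \<in> Y k \<Longrightarrow>
        0 < \<delta> k j \<and> \<delta> k j \<le> 1 \<and> 0 < G k j \<and> 0 < \<epsilon>p k j \<and> \<epsilon>p k j \<le> \<epsilon>\<^sub>0"
    and D_exp: "\<And>\<epsilon> k j. k \<in> {1..N} \<Longrightarrow> j \<in> Y k \<Longrightarrow> 0 < \<epsilon> \<Longrightarrow> \<epsilon> \<le> \<epsilon>p k j \<Longrightarrow>
        \<bar>p \<epsilon> k j - (\<Sum>l\<in>{lm k j..lp k j}. a k j l * \<epsilon> powi l)\<bar>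
          \<le> G k j * \<epsilon> powr (real_of_int (lp k j) + \<delta> k j)"
    \<comment> \<open>Condition E'\<close>
    and E_m: "\<And>k j. k \<in> {1..N} \<Longrightarrow> j \<in> Y k \<Longrightarrow> mm k j \<le> mp k j \<and> b k j (mm k j) > 0"
    and E_par: "\<And>k j. k \<in> {1..N} \<Longrightarrow> j \<in> Y k \<Longrightarrow>
        0 < \<delta>d k j \<and> \<delta>d k j \<le> 1 \<and> 0 < Gd k j \<and> 0 < \<epsilon>e k j \<and> \<epsilon>e k j \<le> \<epsilon>\<^sub>0"
    and E_exp: "\<And>\<epsilon> k j. k \<in> {1..N} \<Longrightarrow> j \<in> Y k \<Longrightarrow> 0 < \<epsilon> \<Longrightarrow> \<epsilon> \<le> \<epsilon>e k j \<Longrightarrow>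
        \<bar>kernel_mean (Q \<epsilon> k j) - (\<Sum>l\<in>{mm k j..mp k j}. b k j l * \<epsilon> powi l)\<bar>
          \<le> Gd k j * \<epsilon> powr (real_of_int (mp k j) + \<delta>d k j)"
  shows "\<exists>Mm Mp :: int. \<exists>B :: int \<Rightarrow> real. \<exists>Gs \<epsilon>s :: real.
           Mm \<le> Mp \<and> B Mm \<noteq> 0 \<and> 0 < Gs \<and> 0 < \<epsilon>s \<and> \<epsilon>s \<le> \<epsilon>\<^sub>0 \<and>
           (\<forall>\<epsilon>. 0 < \<epsilon> \<and> \<epsilon> \<le> \<epsilon>s \<longrightarrow>
              \<bar>expected_return_time (M \<epsilon>) (\<eta> \<epsilon>) (\<kappa> \<epsilon>) i - (\<Sum>l\<in>{Mm..Mp}. B l * \<epsilon> powi l)\<bar>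
                \<le> Gs * \<epsilon> powr (real_of_int Mp +
                     Min {min (\<delta> k j) (\<delta>d k j) | k j. k \<in> {1..N} \<and> j \<in> Y k}))"
proof -
  define D where "D = {min (\<delta> k j) (\<delta>d k j) | k j. k \<in> {1..N} \<and> j \<in> Y k}"
  define d where "d = Min D"
  have Y_sub: "Y k \<subseteq> {1..N}" if "k \<in> {1..N}" for k using A_Y[OF that] by blast
  have "D = (\<Union>k\<in>{1..N}. (\<lambda>j. min (\<delta> k j) (\<delta>d k j)) ` Y k)"
    unfolding D_def by blast
  moreover have "finite (Y k)" if "k \<in> {1..N}" for k
    using Y_sub[OF that] by (rule finite_subset) simp
  ultimately have "finite D" by simp
  moreover obtain j where "j \<in> Y i" using A_Y[OF i_in] by blast
  then have "min (\<delta> i j) (\<delta>d i j) \<in> D" unfolding D_def using i_in by blast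
  \<comment> \<open>The minimum is attained, so \<open>d\<close> inherits \<open>0 < d\<close> and
    \<open>d <= 1\<close> from some pair of states.\<close>
  ultimately have "d \<in> D" unfolding d_def by (intro Min_in) auto
  then obtain k j where "d = min (\<delta> k j) (\<delta>d k j)" "k \<in> {1..N}" "j \<in> Y k"
    unfolding D_def by blast
  then have d: "0 < d" "d \<le> 1" using D_par[of k j] E_par[of k j] by auto
  have d_le: "d \<le> \<delta> k j" "d \<le> \<delta>d k j" if "k \<in> {1..N}" "j \<in> Y k" for k j
  proof -
    have "min (\<delta> k j) (\<delta>d k j) \<in> D" using that unfolding D_def by blast
    then have "d \<le> min (\<delta> k j) (\<delta>d k j)" unfolding d_def by (rule Min_le[OF \<open>finite D\<close>])
    then show "d \<le> \<delta> k j" "d \<le> \<delta>d k j" by auto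
  qed
  have ev: "\<forall>\<^sub>F \<epsilon> in at_right 0. \<epsilon> \<in> {0<..\<epsilon>\<^sub>0}"
    using eventually_at_right_real[OF eps0(1)] by (auto elim: eventually_mono)
  have sm: "semi_markov (M \<epsilon>) (\<eta> \<epsilon>) (\<kappa> \<epsilon>) (Q \<epsilon>) (p \<epsilon>) N i Y" if "\<epsilon> \<in> {0<..\<epsilon>\<^sub>0}" for \<epsilon>
    by (rule semi_markov.intro)
      (rule proc i_in Q_mono Q_rcont Q_zero Q_p e_fin Y_sub A_a A_b A_c; (rule that | assumption))+
  define x where "x a \<epsilon> = semi_markov.v (M \<epsilon>) (\<eta> \<epsilon>) i a" for a \<epsilon>
  define e where "e a \<epsilon> = (\<Sum>b\<in>{1..N}. kernel_mean (Q \<epsilon> a b))" for a \<epsilon>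

  have p_pivotal: "pivotal d (\<lambda>\<epsilon>. p \<epsilon> k j)" if "k \<in> {1..N}" "j \<in> Y k" for k j
    using D_l[OF that] D_par[OF that] d_le(1)[OF that] D_exp[OF that]
    by (intro pivotalI_laurent[where l = "lm k j" and u = "lp k j" and a = "a k j"
          and c = "\<epsilon>p k j" and e = "\<delta> k j" and C = "G k j"]) auto
  have p_pivotal0: "pivotal0 d (\<lambda>\<epsilon>. p \<epsilon> k j)" if "k \<in> {1..N}" "j \<in> {1..N}" for k j
    using p_pivotal[OF that(1)] eventually_mono[OF ev A_b[OF _ that]] unfolding pivotal0_def
    by (cases "j \<in> Y k") auto
  have m_pivotal: "pivotal d (\<lambda>\<epsilon>. kernel_mean (Q \<epsilon> k j))" if "k \<in> {1..N}" "j \<in> Y k" for k j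
    using E_m[OF that] E_par[OF that] d_le(2)[OF that] E_exp[OF that]
    by (intro pivotalI_laurent[where l = "mm k j" and u = "mp k j" and a = "b k j"
          and c = "\<epsilon>e k j" and e = "\<delta>d k j" and C = "Gd k j"]) auto
  have m_pivotal0: "pivotal0 d (\<lambda>\<epsilon>. kernel_mean (Q \<epsilon> k j))" if "k \<in> {1..N}" "j \<in> {1..N}" for k j
    using m_pivotal[OF that(1)] eventually_mono[OF ev semi_markov.kernel_mean_zero[OF sm that]]
    unfolding pivotal0_def by (cases "j \<in> Y k") auto
  have e_pivotal: "pivotal d (e k)" if k: "k \<in> {1..N}" for k
  proof -
    obtain j where "j \<in> Y k" using A_Y[OF k] by blast
    then show ?thesis unfolding e_def[abs_def]
      using Y_sub[OF k] by (intro pivotal_sum[OF _ _ d, where b = j] m_pivotal m_pivotal0 k) auto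
  qed

  have x_i: "x i \<epsilon> = 1" if "\<epsilon> \<in> {0<..\<epsilon>\<^sub>0}" for \<epsilon>
    unfolding x_def by (rule semi_markov.v_i[OF sm[OF that]])
  \<comment> \<open>The unknowns are the visits to the states other than \<open>i\<close>. As
    \<open>x i = 1\<close>, row \<open>i\<close> becomes the inhomogeneous term \<open>s\<close>,
    and column \<open>i\<close> gives the exit weights \<open>r\<close>.\<close>
  have x_pivotal0: "pivotal0 d (x j)" if "j \<in> {1..N} - {i}" for j
  proof (rule pivotal0_solution[where S = "{1..N} - {i}" and q = "\<lambda>k j \<epsilon>. p \<epsilon> k j"
      and r = "\<lambda>k \<epsilon>. p \<epsilon> k i" and s = "\<lambda>j \<epsilon>. p \<epsilon> i j"])
    fix k assume k: "k \<in> {1..N} - {i}"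
    show "\<forall>\<^sub>F \<epsilon> in at_right 0. (\<Sum>j\<in>{1..N} - {i}. p \<epsilon> k j) + p \<epsilon> k i = 1"
      using ev
    proof eventually_elim
      case (elim \<epsilon>)
      then show ?case
        using semi_markov.row_sum[OF sm[OF elim], of k] k i_in by (simp add: sum.remove[of _ i])
    qed
    show "\<forall>\<^sub>F \<epsilon> in at_right 0. x k \<epsilon> = p \<epsilon> i k + (\<Sum>l\<in>{1..N} - {i}. x l \<epsilon> * p \<epsilon> l k)"
      using ev
    proof eventually_elim
      case (elim \<epsilon>)
      have "x k \<epsilon> = (\<Sum>l\<in>{1..N}. x l \<epsilon> * p \<epsilon> l k)"
        unfolding x_def using semi_markov.v_eq[OF sm[OF elim], of k] k by blast
      then show ?case using i_in x_i[OF elim] by (simp add: sum.remove[of _ i])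
    qed
  next
    fix T assume T: "T \<subseteq> {1..N} - {i}" "T \<noteq> {}"
    then obtain k where k: "k \<in> T" "k \<in> {1..N}" by blast
    \<comment> \<open>A path from \<open>T\<close> to \<open>i\<close> has to leave
      \<open>T\<close>. At the first time \<open>m\<close> outside \<open>T\<close> the preceding
      state is still in \<open>T\<close>, and the step between them has a pivotal
      probability.\<close>
    obtain n :: nat and l where l: "l 0 = k" "l n = i" "\<And>m. m \<in> {1..n} \<Longrightarrow> l m \<in> Y (l (m - 1))"
      using A_c[OF k(2) i_in] by metis
    define m where "m = (LEAST m. l m \<notin> T)"
    have "l n \<notin> T" using l(2) T(1) by auto
    then have m: "l m \<notin> T" "m \<le> n"
      unfolding m_def by (rule LeastI[of "\<lambda>m. l m \<notin> T"], intro Least_le)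
    have "m \<noteq> 0" using m(1) l(1) k(1) by metis
    then have T': "l (m - 1) \<in> T"
      using not_less_Least[of "m - 1" "\<lambda>m. l m \<notin> T"] unfolding m_def by simp
    then have in_N: "l (m - 1) \<in> {1..N}" using T(1) by blast
    have step: "l m \<in> Y (l (m - 1))" using l(3) m(2) \<open>m \<noteq> 0\<close> by simp
    then have "l m \<in> {1..N}" using Y_sub[OF in_N] by blast
    with p_pivotal[OF in_N step] T' m(1) show "\<exists>k\<in>T. pivotal d (\<lambda>\<epsilon>. p \<epsilon> k i) \<or> (\<exists>j\<in>{1..N} - {i} - T. pivotal d (\<lambda>\<epsilon>. p \<epsilon> k j))"
      by blast
  qed (use that d i_in p_pivotal0 in auto)

  \<comment> \<open>The other \<open>x k\<close> are only known to be pivotal or eventually zero;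
    the visit to \<open>i\<close> supplies the summand with a positive leading term.\<close>
  have xe_pivotal: "pivotal d (\<lambda>\<epsilon>. x i \<epsilon> * e i \<epsilon>)"
    by (rule pivotal_cong[OF _ e_pivotal[OF i_in]]) (use ev x_i in \<open>auto elim!: eventually_mono\<close>)
  have "pivotal0 d (\<lambda>\<epsilon>. x k \<epsilon> * e k \<epsilon>)" if "k \<in> {1..N}" for k
    using xe_pivotal pivotal0_mult[OF x_pivotal0[of k], of "e k"] e_pivotal[OF that] that d
    by (cases "k = i") (auto simp: pivotal0_def)
  then have F: "pivotal d (\<lambda>\<epsilon>. \<Sum>k\<in>{1..N}. x k \<epsilon> * e k \<epsilon>)"
    by (intro pivotal_sum[where f = "\<lambda>k \<epsilon>. x k \<epsilon> * e k \<epsilon>", OF _ _ d i_in xe_pivotal]) auto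
  obtain l u a C c where *:
    "l \<le> u" "0 < a l" "0 < C" "0 < c" "c \<le> \<epsilon>\<^sub>0"
    "\<And>\<epsilon>. 0 < \<epsilon> \<Longrightarrow> \<epsilon> \<le> c \<Longrightarrow>
      \<bar>(\<Sum>k\<in>{1..N}. x k \<epsilon> * e k \<epsilon>) - (\<Sum>n\<in>{l..u}. a n * \<epsilon> powi n)\<bar> \<le> C * \<epsilon> powr (of_int u + d)"
    using pivotalE_laurent[OF F d eps0(1)] by blast
  have "expected_return_time (M \<epsilon>) (\<eta> \<epsilon>) (\<kappa> \<epsilon>) i = (\<Sum>k\<in>{1..N}. x k \<epsilon> * e k \<epsilon>)"
    if "0 < \<epsilon>" "\<epsilon> \<le> c" for \<epsilon>
    unfolding x_def e_def
    by (rule semi_markov.expected_return_time_eq[OF sm]) (use that *(5) in auto)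
  with * show ?thesis
    unfolding D_def[symmetric] d_def[symmetric]
    by (intro exI[of _ l] exI[of _ u] exI[of _ a] exI[of _ C] exI[of _ c]) auto
qed

end
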